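(* Let $\alpha\in\mathbb{R}$, let $B$ be a finite Blaschke product of degree $n\ge 1$, and let $u_1,\dots,u_n$ be an (algebraic) basis of the model space $K_B=H^2\ominus BH^2$. A bounded linear operator $W$ on $\mathcal{A}_\alpha$ commutes with $T_B$ if and only if there exist $\phi_1,\dots,\phi_n\in\mathcal{M}_\alpha$ such that $$W\Big(\sum_{j=1}^n u_j\,(f_j\circ B)\Big)=\sum_{k=1}^n \phi_k\,(f_k\circ B)\qquad\text{for all } f_1,\dots,f_n\in\mathcal{A}_\alpha .$$
   Context: $\mathbb{D}$ is the open unit disc. For $\alpha\in\mathbb{R}$, $\mathcal{A}_\alpha$ is the Hilbert space of analytic functions $f(z)=\sum_{k\ge0}a_kz^k$ on $\mathbb{D}$ with $\|f\|_\alpha^2=\sum_{k\ge0}|a_k|^2(k+1)^\alpha<\infty$. $\mathcal{M}_\alpha$ is its multiplier algebra: the analytic functions $\varphi$ on $\mathbb{D}$ with $\varphi f\in\mathcal{A}_\alpha$ for every $f\in\mathcal{A}_\alpha$. A finite Blaschke product of degree $n$ is $B(z)=e^{i\theta}\prod_{i=1}^n\frac{z-\alpha_i}{1-\overline{\alpha_i}z}$ with $\theta\in\mathbb{R}$ and $\alpha_i\in\mathbb{D}$ (repetitions allowed). $T_B$ denotes the operator $f\mapsto Bf$ on $\mathcal{A}_\alpha$. $H^2=\mathcal{A}_0$ is the Hardy space, and $K_B=H^2\ominus BH^2$ is the $n$-dimensional orthogonal complement of $BH^2$ in $H^2$. Known fact: composition with $B$ and multiplication by elements of $K_B$ are bounded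 on $\mathcal{A}_\alpha$, and every $f\in\mathcal{A}_\alpha$ has a unique decomposition $f=\sum_{j=1}^n u_j\,(f_j\circ B)$ with $f_1,\dots,f_n\in\mathcal{A}_\alpha$. *)

theory Defs
  imports "HOL-Complex_Analysis.Complex_Analysis" "HOL-Library.Function_Algebras"
begin

text \<open>
  An analytic function on the open unit disc is represented by the total function that
  extends it by zero, so that each analytic function has exactly one representative and
  equality in HOL is equality of functions on the disc. Sums and products of functions are the
  pointwise ones. The composition \<open>f \<circ> B\<close> occurs only in products \<open>v * (f \<circ> B)\<close> in which \<open>v\<close>
  vanishes off the disc, so the values of \<open>B\<close> there play no role.
\<close>

definition disc_analytic :: "(complex \<Rightarrow> complex) set" where
  "disc_analytic = {f. f holomorphic_on ball 0 1 \<and> (\<forall>z. z \<notin> ball 0 1 \<longrightarrow> f z = 0)}"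

definition coef :: "(complex \<Rightarrow> complex) \<Rightarrow> nat \<Rightarrow> complex" where
  "coef f k = fps_nth (fps_expansion f 0) k"

definition A_space :: "real \<Rightarrow> (complex \<Rightarrow> complex) set" where
  "A_space \<alpha> = {f \<in> disc_analytic. summable (\<lambda>k. (cmod (coef f k))\<^sup>2 * real (k + 1) powr \<alpha>)}"

definition A_norm :: "real \<Rightarrow> (complex \<Rightarrow> complex) \<Rightarrow> real" where
  "A_norm \<alpha> f = sqrt (\<Sum>k. (cmod (coef f k))\<^sup>2 * real (k + 1) powr \<alpha>)"

definition multipliers :: "real \<Rightarrow> (complex \<Rightarrow> complex) set" where
  "multipliers \<alpha> = {\<phi> \<in> disc_analytic. \<forall>f\<in>A_space \<alpha>. \<phi> * f \<in> A_space \<alpha>}"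

definition fscale :: "complex \<Rightarrow> (complex \<Rightarrow> complex) \<Rightarrow> complex \<Rightarrow> complex" where
  "fscale c f = (\<lambda>z. c * f z)"

global_interpretation cfun: vector_space fscale
  by unfold_locales (simp_all add: fscale_def fun_eq_iff algebra_simps)

definition bounded_operator :: "real \<Rightarrow> ((complex \<Rightarrow> complex) \<Rightarrow> complex \<Rightarrow> complex) \<Rightarrow> bool" where
  "bounded_operator \<alpha> W \<longleftrightarrow>
     (\<forall>f\<in>A_space \<alpha>. W f \<in> A_space \<alpha>) \<and>
     (\<forall>f\<in>A_space \<alpha>. \<forall>g\<in>A_space \<alpha>. W (f + g) = W f + W g) \<and>
     (\<forall>c. \<forall>f\<in>A_space \<alpha>. W (fscale c f) = fscale c (W f)) \<and>
     (\<exists>C. \<forall>f\<in>A_space \<alpha>. A_norm \<alpha> (W f) \<le> C * A_norm \<alpha> f)"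

definition finite_Blaschke_product :: "nat \<Rightarrow> (complex \<Rightarrow> complex) \<Rightarrow> bool" where
  "finite_Blaschke_product n B \<longleftrightarrow>
     (\<exists>(\<theta>::real) a. (\<forall>i\<in>{1..n}. a i \<in> ball 0 1) \<and>
        (\<forall>z\<in>ball 0 1. B z = exp (\<i> * of_real \<theta>) * (\<Prod>i=1..n. (z - a i) / (1 - cnj (a i) * z))))"

definition T_op :: "(complex \<Rightarrow> complex) \<Rightarrow> (complex \<Rightarrow> complex) \<Rightarrow> complex \<Rightarrow> complex" where
  "T_op B f = B * f"

definition Hardy2 :: "(complex \<Rightarrow> complex) set" where
  "Hardy2 = A_space 0"

definition Hardy2_inner :: "(complex \<Rightarrow> complex) \<Rightarrow> (complex \<Rightarrow> complex) \<Rightarrow> complex" where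
  "Hardy2_inner f g = (\<Sum>k. coef f k * cnj (coef g k))"

definition model_space :: "(complex \<Rightarrow> complex) \<Rightarrow> (complex \<Rightarrow> complex) set" where
  "model_space B = {f \<in> Hardy2. \<forall>g\<in>Hardy2. Hardy2_inner f (B * g) = 0}"

definition basis_family :: "nat \<Rightarrow> (nat \<Rightarrow> complex \<Rightarrow> complex) \<Rightarrow> (complex \<Rightarrow> complex) set \<Rightarrow> bool" where
  "basis_family n u K \<longleftrightarrow>
     inj_on u {1..n} \<and> cfun.independent (u ` {1..n}) \<and> cfun.span (u ` {1..n}) = K"

end

theory Submission
  imports Defs "HOL-Real_Asymp.Real_Asymp" "HOL-Library.Discrete_Functions"
begin

text \<open>
  Multiplication by \<open>B\<close> is an isometry of \<open>H\<^sup>2\<close>, so the spaces \<open>B^m K\<^sub>B\<close> are mutually orthogonal.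
  Hence for \<open>v \<in> K\<^sub>B\<close> the map \<open>f \<mapsto> v (f \<circ> B)\<close> is a multiple of an isometry of \<open>H\<^sup>2\<close>; in the
  monomials it is a matrix \<open>t\<close> that is bounded on \<open>\<ell>\<^sup>2\<close>, where \<open>t k m\<close> is the coefficient of \<open>z^k\<close>
  in \<open>v B^m\<close>. Both \<open>B\<close> and \<open>v\<close> extend holomorphically across the unit circle, so by Cauchy's
  estimates \<open>t k m\<close> is exponentially small unless \<open>k\<close> and \<open>m\<close> are comparable. The weight
  \<open>(k + 1) powr \<alpha>\<close> hardly changes between comparable indices, and therefore such a matrix is bounded
  for every weight (\<open>off_diagonal_decay_section_bounded\<close>). Both properties of \<open>t\<close> are shared
  by its adjoint, which is therefore bounded for every weight too.

  The adjoints produce the decomposition of \<open>f\<close> in \<open>\<A>\<^sub>\<alpha>\<close>. If \<open>v\<^sub>1, \<dots>, v\<^sub>n\<close> is the basis of \<open>K\<^sub>B\<close>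
  dual to \<open>u\<^sub>1, \<dots>, u\<^sub>n\<close>, then the reproducing kernel
  \<open>(1 - cnj (B w) B z) / (1 - cnj w z)\<close> of \<open>K\<^sub>B\<close> equals \<open>\<Sum>j. cnj (v\<^sub>j w) u\<^sub>j z\<close>. Dividing by the
  numerator and comparing the powers of \<open>cnj w\<close> writes \<open>z^k\<close> as \<open>\<Sum>j. u\<^sub>j (f\<^sub>j \<circ> B)\<close>, where \<open>f\<^sub>j\<close> is
  the image of \<open>z^k\<close> under the adjoint of the matrix of \<open>v\<^sub>j\<close>. As these adjoints are bounded on
  \<open>\<A>\<^sub>\<alpha>\<close>, the formula passes from polynomials to all of \<open>\<A>\<^sub>\<alpha>\<close> (\<open>decomposition\<close>).

  If \<open>W\<close> commutes with \<open>T\<^sub>B\<close>, put \<open>\<phi>\<^sub>k = W u\<^sub>k\<close>. Then \<open>W (u\<^sub>k B^m) = \<phi>\<^sub>k B^m\<close>, and by continuity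
  \<open>W (u\<^sub>k (g \<circ> B)) = \<phi>\<^sub>k (g \<circ> B)\<close> for all \<open>g \<in> \<A>\<^sub>\<alpha>\<close>. Decomposing \<open>f\<close> gives
  \<open>\<phi>\<^sub>k f = \<Sum>j. u\<^sub>j W (u\<^sub>k (f\<^sub>j \<circ> B))\<close>, which is in \<open>\<A>\<^sub>\<alpha>\<close> because functions holomorphic across the
  circle are multipliers; so \<open>\<phi>\<^sub>k\<close> is a multiplier. Conversely, replacing every \<open>f\<^sub>j\<close> by \<open>z f\<^sub>j\<close>
  multiplies both \<open>\<Sum>j. u\<^sub>j (f\<^sub>j \<circ> B)\<close> and \<open>\<Sum>k. \<phi>\<^sub>k (f\<^sub>k \<circ> B)\<close> by \<open>B\<close>, so the formula for \<open>W\<close> forces it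
  to commute with \<open>T\<^sub>B\<close>.
\<close>

section \<open>Weighted sequence spaces\<close>

definition weight :: "real \<Rightarrow> nat \<Rightarrow> real" where
  "weight \<alpha> k = real (k + 1) powr \<alpha>"

definition sqnorm :: "real \<Rightarrow> (nat \<Rightarrow> complex) \<Rightarrow> real" where
  "sqnorm \<alpha> a = (\<Sum>k. (cmod (a k))\<^sup>2 * weight \<alpha> k)"

definition weighted_l2 :: "real \<Rightarrow> (nat \<Rightarrow> complex) set" where
  "weighted_l2 \<alpha> = {a. summable (\<lambda>k. (cmod (a k))\<^sup>2 * weight \<alpha> k)}"

definition trunc :: "nat \<Rightarrow> (nat \<Rightarrow> complex) \<Rightarrow> nat \<Rightarrow> complex" where
  "trunc N a = (\<lambda>k. if k < N then a k else 0)"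

lemma weight_pos [simp]: "weight \<alpha> k > 0"
  by (simp add: weight_def)

lemma weight_nonneg [simp]: "weight \<alpha> k \<ge> 0"
  using weight_pos less_imp_le by blast

lemma weight_0 [simp]: "weight 0 k = 1"
  by (simp add: weight_def)

lemma weight_minus: "weight (- \<alpha>) k = inverse (weight \<alpha> k)"
  by (simp add: weight_def powr_minus)

text \<open>
  Indices whose ratio lies between \<open>1 / c\<close> and \<open>c\<close> have comparable weights, whatever the sign of the
  exponent; hence the absolute value.
\<close>

lemma weight_le_ratio:
  assumes "real (k + 1) \<le> c * real (m + 1)" "real (m + 1) \<le> c * real (k + 1)"
  shows "weight \<alpha> k \<le> c powr \<bar>\<alpha>\<bar> * weight \<alpha> m"
proof -
  have c: "c > 0"
    using assms(1) by (smt (verit) mult_nonpos_nonneg of_nat_0_le_iff of_nat_0_less_iff zero_less_Suc Suc_eq_plus1)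
  show ?thesis
  proof (cases "\<alpha> \<ge> 0")
    case True
    have "real (k+1) powr \<alpha> \<le> (c * real (m + 1)) powr \<alpha>"
      using True assms(1) by (intro powr_mono2) auto
    then show ?thesis
      using True c by (simp add: weight_def powr_mult)
  next
    case False
    have "(c * real (k + 1)) powr \<alpha> \<le> real (m+1) powr \<alpha>"
      using False assms(2) by (intro powr_mono2') auto
    then have "c powr \<alpha> * weight \<alpha> k \<le> weight \<alpha> m"
      using c by (simp add: weight_def powr_mult)
    then have "c powr \<bar>\<alpha>\<bar> * (c powr \<alpha> * weight \<alpha> k) \<le> c powr \<bar>\<alpha>\<bar> * weight \<alpha> m"
      by (intro mult_left_mono) auto
    moreover have "c powr \<bar>\<alpha>\<bar> * c powr \<alpha> = 1"
      using False c by (simp add: powr_add [symmetric])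
    ultimately show ?thesis by (metis mult.assoc mult_1)
  qed
qed

lemma summable_weight_power:
  assumes "0 \<le> x" "x < 1"
  shows "summable (\<lambda>k. weight \<beta> k * x ^ k)"
proof (cases "x = 0")
  case True
  then have "(\<lambda>k. weight \<beta> k * x ^ k) = (\<lambda>k. if k = 0 then 1 else 0)"
    by (auto simp: weight_def fun_eq_iff)
  then show ?thesis by simp
next
  case False
  define y where "y = (1 + x) / 2"
  have y: "0 < x" "x < y" "y < 1" using assms False by (auto simp: y_def)
  have "(\<lambda>k. real (k + 1) powr \<beta> * x ^ k) \<in> O(\<lambda>k. y ^ k)"
    using y by real_asymp
  then show ?thesis
    unfolding weight_def by (rule summable_comparison_test_bigo[rotated]) (use y in auto)
qed

lemma square_norm_add_le: "(norm (x + y))\<^sup>2 \<le> 2 * (norm x)\<^sup>2 + 2 * (norm (y::'a::real_normed_vector))\<^sup>2"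
proof -
  have "(norm (x + y))\<^sup>2 \<le> (norm x + norm y)\<^sup>2"
    by (intro power_mono norm_triangle_ineq) auto
  also have "\<dots> \<le> 2 * (norm x)\<^sup>2 + 2 * (norm y)\<^sup>2"
    using zero_le_power2[of "norm x - norm y"] by (simp add: power2_eq_square algebra_simps)
  finally show ?thesis .
qed

lemma weighted_l2_add: 
  assumes "a \<in> weighted_l2 \<alpha>" "b \<in> weighted_l2 \<alpha>"
  shows "(\<lambda>k. a k + b k) \<in> weighted_l2 \<alpha>"
proof -
  have "summable (\<lambda>k. 2 * ((cmod (a k))\<^sup>2 * weight \<alpha> k) + 2 * ((cmod (b k))\<^sup>2 * weight \<alpha> k))"
    using assms by (intro summable_add summable_mult) (auto simp: weighted_l2_def)
  then have "summable (\<lambda>k. (cmod (a k + b k))\<^sup>2 * weight \<alpha> k)"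
  proof (rule summable_comparison_test')
    fix k
    have "(cmod (a k + b k))\<^sup>2 * weight \<alpha> k \<le> (2 * (cmod (a k))\<^sup>2 + 2 * (cmod (b k))\<^sup>2) * weight \<alpha> k"
      by (intro mult_right_mono square_norm_add_le) auto
    then show "norm ((cmod (a k + b k))\<^sup>2 * weight \<alpha> k) \<le> 2 * ((cmod (a k))\<^sup>2 * weight \<alpha> k) + 2 * ((cmod (b k))\<^sup>2 * weight \<alpha> k)"
      by (simp add: algebra_simps)
  qed
  then show ?thesis by (simp add: weighted_l2_def)
qed

lemma weighted_l2_cmult: "a \<in> weighted_l2 \<alpha> \<Longrightarrow> (\<lambda>k. c * a k) \<in> weighted_l2 \<alpha>"
  by (auto simp: weighted_l2_def norm_mult power_mult_distrib mult.assoc intro: summable_mult)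

lemma sqnorm_nonneg: "a \<in> weighted_l2 \<alpha> \<Longrightarrow> 0 \<le> sqnorm \<alpha> a"
  unfolding sqnorm_def weighted_l2_def by (intro suminf_nonneg) auto

lemma sum_le_sqnorm: "a \<in> weighted_l2 \<alpha> \<Longrightarrow> finite I \<Longrightarrow> (\<Sum>k\<in>I. (cmod (a k))\<^sup>2 * weight \<alpha> k) \<le> sqnorm \<alpha> a"
  unfolding sqnorm_def weighted_l2_def by (intro sum_le_suminf) auto

lemma weighted_l2I_bounded:
  assumes "\<And>K. (\<Sum>k<K. (cmod (a k))\<^sup>2 * weight \<alpha> k) \<le> C"
  shows "a \<in> weighted_l2 \<alpha>" "sqnorm \<alpha> a \<le> C"
proof -
  have s: "summable (\<lambda>k. (cmod (a k))\<^sup>2 * weight \<alpha> k)"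
    by (rule summableI_nonneg_bounded) (use assms in auto)
  then show "a \<in> weighted_l2 \<alpha>" by (simp add: weighted_l2_def)
  show "sqnorm \<alpha> a \<le> C"
    unfolding sqnorm_def by (rule suminf_le_const[OF s]) (use assms in auto)
qed

lemma trunc_in_weighted_l2 [simp]: "trunc N a \<in> weighted_l2 \<alpha>"
  unfolding weighted_l2_def mem_Collect_eq by (rule summable_finite[of "{..<N}"]) (auto simp: trunc_def)

lemma sqnorm_tail_tendsto:
  assumes "a \<in> weighted_l2 \<alpha>"
  shows "(\<lambda>N. sqnorm \<alpha> (\<lambda>k. a k - trunc N a k)) \<longlonglongrightarrow> 0"
proof -
  let ?f = "\<lambda>k. (cmod (a k))\<^sup>2 * weight \<alpha> k"
  have s: "summable ?f" using assms by (simp add: weighted_l2_def)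
  have "sqnorm \<alpha> (\<lambda>k. a k - trunc N a k) = suminf ?f - (\<Sum>k<N. ?f k)" for N
  proof -
    let ?g = "\<lambda>k. (cmod (a k - trunc N a k))\<^sup>2 * weight \<alpha> k"
    have eq: "?g = (\<lambda>k. ?f k - (if k \<in> {..<N} then ?f k else 0))"
      by (auto simp: trunc_def fun_eq_iff)
    have "?g sums (suminf ?f - (\<Sum>k<N. ?f k))"
      unfolding eq by (intro sums_diff summable_sums s sums_If_finite_set) auto
    then show ?thesis by (simp add: sqnorm_def sums_iff)
  qed
  moreover have "(\<lambda>N. suminf ?f - (\<Sum>k<N. ?f k)) \<longlonglongrightarrow> suminf ?f - suminf ?f"
    by (intro tendsto_intros summable_LIMSEQ s)
  ultimately show ?thesis by simp
qed

text \<open>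
  Cauchy-Schwarz with the weight split evenly between the two factors: the geometric factor absorbs
  the reciprocal weight. This makes point evaluations continuous on every weighted space.
\<close>

lemma power_series_sum_bound:
  assumes "cmod z < 1" "finite I"
  shows "(\<Sum>k\<in>I. cmod (a k * z ^ k))\<^sup>2
    \<le> (\<Sum>k\<in>I. (cmod (a k))\<^sup>2 * weight \<alpha> k) * (\<Sum>k. weight (- \<alpha>) k * ((cmod z)\<^sup>2) ^ k)"
proof -
  have eq: "cmod (a k * z ^ k) = (cmod (a k) * sqrt (weight \<alpha> k)) * (sqrt (weight (-\<alpha>) k) * cmod z ^ k)" for k
  proof -
    have "sqrt (weight \<alpha> k) * sqrt (weight (-\<alpha>) k) = 1"
      by (simp add: weight_minus real_sqrt_inverse less_imp_neq[OF weight_pos, symmetric])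
    then show ?thesis by (simp add: norm_mult norm_power mult.assoc mult.left_commute)
  qed
  have "(\<Sum>k\<in>I. cmod (a k * z ^ k))\<^sup>2 \<le> (\<Sum>k\<in>I. (cmod (a k) * sqrt (weight \<alpha> k))\<^sup>2) * (\<Sum>k\<in>I. (sqrt (weight (-\<alpha>) k) * cmod z ^ k)\<^sup>2)"
    unfolding eq by (rule Cauchy_Schwarz_ineq_sum)
  also have "\<dots> = (\<Sum>k\<in>I. (cmod (a k))\<^sup>2 * weight \<alpha> k) * (\<Sum>k\<in>I. weight (-\<alpha>) k * ((cmod z)\<^sup>2) ^ k)"
    by (simp add: power_mult_distrib power_mult [symmetric] mult.commute)
  also have "\<dots> \<le> (\<Sum>k\<in>I. (cmod (a k))\<^sup>2 * weight \<alpha> k) * (\<Sum>k. weight (-\<alpha>) k * ((cmod z)\<^sup>2) ^ k)"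
    using assms by (intro mult_left_mono sum_le_suminf summable_weight_power sum_nonneg)
      (auto simp: power_less_one_iff abs_square_less_1)
  finally show ?thesis .
qed

lemma weighted_l2_power_series_summable:
  assumes "a \<in> weighted_l2 \<alpha>" "cmod z < 1"
  shows "summable (\<lambda>k. cmod (a k * z ^ k))"
    "(cmod (\<Sum>k. a k * z ^ k))\<^sup>2 \<le> sqnorm \<alpha> a * (\<Sum>k. weight (- \<alpha>) k * ((cmod z)\<^sup>2) ^ k)"
proof -
  let ?E = "(\<Sum>k. weight (- \<alpha>) k * ((cmod z)\<^sup>2) ^ k)"
  have E: "?E \<ge> 0"
    using assms by (intro suminf_nonneg summable_weight_power) (auto simp: abs_square_less_1)
  have *: "(\<Sum>k<K. cmod (a k * z ^ k)) \<le> sqrt (sqnorm \<alpha> a * ?E)" for K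
  proof (rule real_le_rsqrt)
    have "(\<Sum>k<K. cmod (a k * z ^ k))\<^sup>2 \<le> (\<Sum>k<K. (cmod (a k))\<^sup>2 * weight \<alpha> k) * ?E"
      by (rule power_series_sum_bound) (use assms in auto)
    also have "\<dots> \<le> sqnorm \<alpha> a * ?E"
      by (intro mult_right_mono sum_le_sqnorm assms E) auto
    finally show "(\<Sum>k<K. cmod (a k * z ^ k))\<^sup>2 \<le> sqnorm \<alpha> a * ?E" .
  qed
  show s: "summable (\<lambda>k. cmod (a k * z ^ k))"
    by (rule summableI_nonneg_bounded) (use * in auto)
  have "cmod (\<Sum>k. a k * z ^ k) \<le> sqrt (sqnorm \<alpha> a * ?E)"
    using summable_norm[OF s] suminf_le_const[OF s, of "sqrt (sqnorm \<alpha> a * ?E)"] * by force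
  then have "(cmod (\<Sum>k. a k * z ^ k))\<^sup>2 \<le> (sqrt (sqnorm \<alpha> a * ?E))\<^sup>2"
    by (intro power_mono) auto
  then show "(cmod (\<Sum>k. a k * z ^ k))\<^sup>2 \<le> sqnorm \<alpha> a * ?E"
    using E sqnorm_nonneg[OF assms(1)] by simp
qed

lemma weighted_l2_diff:
  assumes "a \<in> weighted_l2 \<alpha>" "b \<in> weighted_l2 \<alpha>"
  shows "(\<lambda>k. a k - b k) \<in> weighted_l2 \<alpha>"
  using weighted_l2_add[OF assms(1) weighted_l2_cmult[OF assms(2), of "-1"]] by simp

text \<open>
  Norm convergence implies pointwise convergence on the disc. This carries identities from
  Taylor polynomials over to all functions of the weighted spaces.
\<close>

lemma power_series_tendsto:
  assumes "a \<in> weighted_l2 \<alpha>" "\<And>N. b N \<in> weighted_l2 \<alpha>" "(\<lambda>N. sqnorm \<alpha> (\<lambda>k. a k - b N k)) \<longlonglongrightarrow> 0" "cmod z < 1"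
  shows "(\<lambda>N. \<Sum>k. b N k * z ^ k) \<longlonglongrightarrow> (\<Sum>k. a k * z ^ k)"
proof -
  let ?E = "(\<Sum>k. weight (- \<alpha>) k * ((cmod z)\<^sup>2) ^ k)"
  have "(\<lambda>N. sqrt (sqnorm \<alpha> (\<lambda>k. a k - b N k) * ?E)) \<longlonglongrightarrow> sqrt (0 * ?E)"
    by (intro tendsto_intros assms)
  then have lim: "(\<lambda>N. sqrt (sqnorm \<alpha> (\<lambda>k. a k - b N k) * ?E)) \<longlonglongrightarrow> 0" by simp
  have "(\<lambda>N. (\<Sum>k. a k * z ^ k) - (\<Sum>k. b N k * z ^ k)) \<longlonglongrightarrow> 0"
  proof (rule Lim_null_comparison[OF _ lim], intro always_eventually allI)
    fix N
    have "(\<Sum>k. a k * z ^ k) - (\<Sum>k. b N k * z ^ k) = (\<Sum>k. a k * z ^ k - b N k * z ^ k)"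
      by (intro suminf_diff summable_norm_cancel[OF weighted_l2_power_series_summable(1)[OF assms(1,4)]]
        summable_norm_cancel[OF weighted_l2_power_series_summable(1)[OF assms(2,4)]])
    also have "\<dots> = (\<Sum>k. (a k - b N k) * z ^ k)"
      by (simp add: algebra_simps)
    finally have "(cmod ((\<Sum>k. a k * z ^ k) - (\<Sum>k. b N k * z ^ k)))\<^sup>2 \<le> sqnorm \<alpha> (\<lambda>k. a k - b N k) * ?E"
      using weighted_l2_power_series_summable(2)[OF weighted_l2_diff[OF assms(1) assms(2)[of N]] assms(4)] by simp
    then show "cmod ((\<Sum>k. a k * z ^ k) - (\<Sum>k. b N k * z ^ k)) \<le> sqrt (sqnorm \<alpha> (\<lambda>k. a k - b N k) * ?E)"
      by (rule real_le_rsqrt)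
  qed
  from tendsto_diff[OF tendsto_const[of "\<Sum>k. a k * z ^ k"] this] show ?thesis by simp
qed

section \<open>Matrices acting on weighted sequence spaces\<close>

text \<open>
  Boundedness of a matrix on the weighted space, tested on finite sections only, so that no question
  of convergence enters while norms are being estimated.
\<close>

definition section_bounded :: "real \<Rightarrow> (nat \<Rightarrow> nat \<Rightarrow> complex) \<Rightarrow> real \<Rightarrow> bool" where
  "section_bounded \<alpha> t C \<longleftrightarrow> 0 \<le> C \<and> (\<forall>K M a. (\<Sum>k<K. (cmod (\<Sum>m<M. t k m * a m))\<^sup>2 * weight \<alpha> k)
     \<le> C * (\<Sum>m<M. (cmod (a m))\<^sup>2 * weight \<alpha> m))"

definition mat_app :: "(nat \<Rightarrow> nat \<Rightarrow> complex) \<Rightarrow> (nat \<Rightarrow> complex) \<Rightarrow> nat \<Rightarrow> complex" where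
  "mat_app t a k = (\<Sum>m. t k m * a m)"

lemma section_bounded_row_summable:
  assumes "section_bounded \<alpha> t C" "a \<in> weighted_l2 \<alpha>"
  shows "summable (\<lambda>m. t k m * a m)"
proof (rule summable_norm_cancel, rule summableI_nonneg_bounded)
  fix M
  \<comment> \<open>Rotating the entries of a makes all terms of the row nonnegative without increasing the norm of a.\<close>
  define b where "b m = cnj (sgn (t k m * a m)) * a m" for m
  have b: "t k m * b m = of_real (cmod (t k m * a m))" for m
  proof -
    have "t k m * b m = (t k m * a m) * cnj (t k m * a m) / of_real (cmod (t k m * a m))"
      by (simp add: b_def sgn_eq)
    also have "\<dots> = of_real (cmod (t k m * a m))"
      by (simp only: complex_norm_square [symmetric] power2_eq_square of_real_mult) simp
    finally show ?thesis .
  qed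
  have bn: "(cmod (b m))\<^sup>2 \<le> (cmod (a m))\<^sup>2" for m
    by (intro power_mono) (auto simp: b_def norm_mult norm_sgn)
  have "(cmod (\<Sum>m<M. t k m * b m))\<^sup>2 * weight \<alpha> k \<le> (\<Sum>k<Suc k. (cmod (\<Sum>m<M. t k m * b m))\<^sup>2 * weight \<alpha> k)"
    by (rule member_le_sum) auto
  also have "\<dots> \<le> C * (\<Sum>m<M. (cmod (b m))\<^sup>2 * weight \<alpha> m)"
    using assms(1) unfolding section_bounded_def by blast
  also have "\<dots> \<le> C * (\<Sum>m<M. (cmod (a m))\<^sup>2 * weight \<alpha> m)"
    using assms(1) by (intro mult_left_mono sum_mono mult_right_mono bn) (auto simp: section_bounded_def)
  also have "\<dots> \<le> C * sqnorm \<alpha> a"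
    using assms by (intro mult_left_mono sum_le_sqnorm) (auto simp: section_bounded_def)
  finally have "(cmod (\<Sum>m<M. t k m * b m))\<^sup>2 \<le> C * sqnorm \<alpha> a / weight \<alpha> k"
    by (simp add: pos_le_divide_eq)
  then have "cmod (\<Sum>m<M. t k m * b m) \<le> sqrt (C * sqnorm \<alpha> a / weight \<alpha> k)"
    by (rule real_le_rsqrt)
  moreover have "(\<Sum>m<M. t k m * b m) = of_real (\<Sum>m<M. cmod (t k m * a m))"
    by (simp add: b)
  ultimately show "(\<Sum>m<M. cmod (t k m * a m)) \<le> sqrt (C * sqnorm \<alpha> a / weight \<alpha> k)"
    by (simp only: norm_of_real)
qed auto

lemma mat_app_bounded:
  assumes "section_bounded \<alpha> t C" "a \<in> weighted_l2 \<alpha>"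
  shows "mat_app t a \<in> weighted_l2 \<alpha>" "sqnorm \<alpha> (mat_app t a) \<le> C * sqnorm \<alpha> a"
proof -
  have "(\<Sum>k<K. (cmod (mat_app t a k))\<^sup>2 * weight \<alpha> k) \<le> C * sqnorm \<alpha> a" for K
  proof (rule LIMSEQ_le_const2)
    show "(\<lambda>M. \<Sum>k<K. (cmod (\<Sum>m<M. t k m * a m))\<^sup>2 * weight \<alpha> k) \<longlonglongrightarrow> (\<Sum>k<K. (cmod (mat_app t a k))\<^sup>2 * weight \<alpha> k)"
      unfolding mat_app_def
      by (intro tendsto_intros summable_LIMSEQ section_bounded_row_summable[OF assms])
    have "(\<Sum>k<K. (cmod (\<Sum>m<M. t k m * a m))\<^sup>2 * weight \<alpha> k) \<le> C * sqnorm \<alpha> a" for M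
      using assms mult_left_mono[OF sum_le_sqnorm[OF assms(2), of "{..<M}"], of C]
      unfolding section_bounded_def by (meson finite_lessThan order_trans)
    then show "\<exists>N. \<forall>M\<ge>N. (\<Sum>k<K. (cmod (\<Sum>m<M. t k m * a m))\<^sup>2 * weight \<alpha> k) \<le> C * sqnorm \<alpha> a"
      by blast
  qed
  then show "mat_app t a \<in> weighted_l2 \<alpha>" "sqnorm \<alpha> (mat_app t a) \<le> C * sqnorm \<alpha> a"
    by (rule weighted_l2I_bounded)+
qed

lemma mat_app_diff:
  assumes "section_bounded \<alpha> t C" "a \<in> weighted_l2 \<alpha>" "b \<in> weighted_l2 \<alpha>"
  shows "mat_app t (\<lambda>k. a k - b k) = (\<lambda>k. mat_app t a k - mat_app t b k)"
  unfolding mat_app_def fun_eq_iff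
  by (simp add: right_diff_distrib suminf_diff section_bounded_row_summable[OF assms(1)] assms)

lemma mat_app_trunc: "mat_app t (trunc N a) k = (\<Sum>m<N. t k m * a m)"
proof -
  have "(\<Sum>m. t k m * trunc N a m) = (\<Sum>m<N. t k m * trunc N a m)"
    by (rule suminf_finite) (auto simp: trunc_def)
  then show ?thesis by (simp add: mat_app_def trunc_def)
qed

lemma mat_app_trunc_tendsto:
  assumes "section_bounded \<alpha> t C" "a \<in> weighted_l2 \<alpha>"
  shows "(\<lambda>N. sqnorm \<alpha> (\<lambda>k. mat_app t a k - mat_app t (trunc N a) k)) \<longlonglongrightarrow> 0"
proof (rule tendsto_sandwich)
  have *: "(\<lambda>k. mat_app t a k - mat_app t (trunc N a) k) = mat_app t (\<lambda>k. a k - trunc N a k)" for N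
    by (rule mat_app_diff[symmetric]) (use assms in auto)
  have d: "(\<lambda>k. a k - trunc N a k) \<in> weighted_l2 \<alpha>" for N
    by (intro weighted_l2_diff assms) simp
  show "\<forall>\<^sub>F N in sequentially. 0 \<le> sqnorm \<alpha> (\<lambda>k. mat_app t a k - mat_app t (trunc N a) k)"
    unfolding * by (intro always_eventually allI sqnorm_nonneg mat_app_bounded[OF assms(1)] d)
  show "\<forall>\<^sub>F N in sequentially. sqnorm \<alpha> (\<lambda>k. mat_app t a k - mat_app t (trunc N a) k) \<le> C * sqnorm \<alpha> (\<lambda>k. a k - trunc N a k)"
    unfolding * by (intro always_eventually allI mat_app_bounded[OF assms(1)] d)
  show "(\<lambda>N. C * sqnorm \<alpha> (\<lambda>k. a k - trunc N a k)) \<longlonglongrightarrow> 0"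
    using tendsto_mult[OF tendsto_const[of C] sqnorm_tail_tendsto[OF assms(2)]] by simp
qed auto

definition adjoint_matrix :: "(nat \<Rightarrow> nat \<Rightarrow> complex) \<Rightarrow> nat \<Rightarrow> nat \<Rightarrow> complex" where
  "adjoint_matrix t m k = cnj (t k m)"

text \<open>
  The usual duality \<open>\<parallel>t\<^sup>* a\<parallel>\<^sup>2 = \<langle>t t\<^sup>* a, a\<rangle> \<le> \<parallel>t t\<^sup>* a\<parallel> \<parallel>a\<parallel>\<close>. Only the unweighted case is
  self-dual; the adjoint reaches the other weights through its own off-diagonal decay.
\<close>

lemma section_bounded_adjoint_matrix:
  assumes "section_bounded 0 t C"
  shows "section_bounded 0 (adjoint_matrix t) C"
  unfolding section_bounded_def
proof (intro conjI allI)
  show C: "0 \<le> C" using assms by (simp add: section_bounded_def)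
  fix M K :: nat and a :: "nat \<Rightarrow> complex"
  define y where "y m = (\<Sum>k<K. adjoint_matrix t m k * a k)" for m
  define Y where "Y = (\<Sum>m<M. (cmod (y m))\<^sup>2)"
  define A where "A = (\<Sum>k<K. (cmod (a k))\<^sup>2)"
  have nn: "Y \<ge> 0" "A \<ge> 0" by (auto simp: Y_def A_def intro: sum_nonneg)
  have "complex_of_real Y = (\<Sum>m<M. y m * cnj (y m))"
    by (simp only: Y_def of_real_sum complex_norm_square)
  also have "\<dots> = (\<Sum>m<M. \<Sum>k<K. cnj (t k m * y m) * a k)"
  proof (rule sum.cong)
    fix m
    have "y m * cnj (y m) = (\<Sum>k<K. cnj (t k m) * a k) * cnj (y m)"
      by (simp add: y_def adjoint_matrix_def)
    also have "\<dots> = (\<Sum>k<K. cnj (t k m * y m) * a k)"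
      unfolding sum_distrib_right by (simp add: mult_ac)
    finally show "y m * cnj (y m) = (\<Sum>k<K. cnj (t k m * y m) * a k)" .
  qed simp
  also have "\<dots> = (\<Sum>k<K. cnj (\<Sum>m<M. t k m * y m) * a k)"
    by (subst sum.swap) (simp add: sum_distrib_right)
  finally have "Y = cmod (\<Sum>k<K. cnj (\<Sum>m<M. t k m * y m) * a k)"
    using nn by (metis abs_of_nonneg norm_of_real)
  also have "\<dots> \<le> (\<Sum>k<K. cmod (\<Sum>m<M. t k m * y m) * cmod (a k))"
    by (rule order_trans[OF norm_sum]) (simp add: norm_mult del: cnj_sum)
  finally have "Y\<^sup>2 \<le> (\<Sum>k<K. cmod (\<Sum>m<M. t k m * y m) * cmod (a k))\<^sup>2"
    using nn by (intro power_mono) auto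
  also have "\<dots> \<le> (\<Sum>k<K. (cmod (\<Sum>m<M. t k m * y m))\<^sup>2) * A"
    unfolding A_def by (rule Cauchy_Schwarz_ineq_sum)
  also have "\<dots> \<le> (C * Y) * A"
    using assms nn by (intro mult_right_mono) (auto simp: section_bounded_def Y_def)
  finally have "Y * Y \<le> Y * (C * A)" by (simp add: power2_eq_square mult_ac)
  then have "Y \<le> C * A"
    using nn C by (cases "Y = 0") auto
  then show "(\<Sum>m<M. (cmod (\<Sum>k<K. adjoint_matrix t m k * a k))\<^sup>2 * weight 0 m) \<le> C * (\<Sum>k<K. (cmod (a k))\<^sup>2 * weight 0 k)"
    by (simp add: Y_def A_def y_def)
qed

text \<open>
  The two bounds are Cauchy estimates on a circle outside and on a circle inside the unit disc.
  Each is useless near the diagonal, but the first makes the entry exponentially small when \<open>k\<close> is a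
  large multiple of \<open>m\<close>, the second when \<open>m\<close> is a large multiple of \<open>k\<close>. The condition is symmetric
  in \<open>k\<close> and \<open>m\<close> so that it passes to the adjoint.
\<close>

definition off_diagonal_decay :: "(nat \<Rightarrow> nat \<Rightarrow> complex) \<Rightarrow> bool" where
  "off_diagonal_decay t \<longleftrightarrow> (\<exists>V M s. V \<ge> 0 \<and> M \<ge> 1 \<and> 0 < s \<and> s < 1 \<and>
     (\<forall>k m. cmod (t k m) \<le> V * M ^ m * s ^ k \<and> cmod (t k m) \<le> V * M ^ k * s ^ m))"

lemma off_diagonal_decay_adjoint_matrix: "off_diagonal_decay t \<Longrightarrow> off_diagonal_decay (adjoint_matrix t)"
  unfolding off_diagonal_decay_def adjoint_matrix_def by (metis complex_mod_cnj)

text \<open>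
  The index of the dyadic block containing \<open>k\<close>; the shift by one matches the weight, which is a
  power of \<open>k + 1\<close>.
\<close>

abbreviation dyad :: "nat \<Rightarrow> nat" where "dyad k \<equiv> floor_log (Suc k)"

lemma dyadic_ratio:
  assumes "dyad k \<le> dyad m + L"
  shows "k + 1 \<le> 2 ^ (L + 1) * (m + 1)"
proof -
  have "Suc k < 2 * 2 ^ dyad k" by (rule floor_log_exp2_gt)
  also have "\<dots> \<le> 2 * 2 ^ (dyad m + L)" using assms by (intro mult_left_mono power_increasing) auto
  also have "\<dots> = 2 ^ (L + 1) * 2 ^ dyad m" by (simp add: power_add)
  also have "\<dots> \<le> 2 ^ (L + 1) * (m + 1)"
    using floor_log_exp2_le[of "Suc m"] by (intro mult_left_mono) auto
  finally show ?thesis by simp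
qed

lemma weight_dyadic:
  assumes "dyad k \<le> dyad m + L" "dyad m \<le> dyad k + L"
  shows "weight \<alpha> k \<le> (2 ^ (L + 1)) powr \<bar>\<alpha>\<bar> * weight \<alpha> m"
proof (rule weight_le_ratio)
  show "real (k + 1) \<le> 2 ^ (L + 1) * real (m + 1)"
    using of_nat_mono[OF dyadic_ratio[OF assms(1)], where ?'a = real] by (simp only: of_nat_mult of_nat_power of_nat_numeral)
  show "real (m + 1) \<le> 2 ^ (L + 1) * real (k + 1)"
    using of_nat_mono[OF dyadic_ratio[OF assms(2)], where ?'a = real] by (simp only: of_nat_mult of_nat_power of_nat_numeral)
qed

lemma dyadic_far:
  assumes "dyad m + L < dyad k"
  shows "2 ^ L * m \<le> k"
proof -
  have "2 ^ L * (m + 1) \<le> 2 ^ L * (2 * 2 ^ dyad m)"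
    using floor_log_exp2_gt[of "Suc m"] by (intro mult_left_mono) auto
  also have "\<dots> = 2 ^ (dyad m + L + 1)" by (simp add: power_add)
  also have "\<dots> \<le> 2 ^ dyad k" using assms by (intro power_increasing) auto
  also have "\<dots> \<le> k + 1" using floor_log_exp2_le[of "Suc k"] by simp
  finally have "2 ^ L * m + 2 ^ L \<le> k + 1" by (simp add: algebra_simps)
  moreover have "(1::nat) \<le> 2 ^ L" by simp
  ultimately show ?thesis by linarith
qed

text \<open>
  If \<open>D\<close> is so large that \<open>M s^D \<le> 1\<close>, then \<open>M^m s^k \<le> s^(k - D m)\<close>, and for
  \<open>k \<ge> (2 D + 1) m\<close> the exponent is at least half of \<open>k + m\<close>.
\<close>

lemma off_diagonal_decay_far:
  assumes "off_diagonal_decay t"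
  obtains L V q where "V \<ge> 0" "0 < q" "q < 1"
    "\<And>k m. \<not> (dyad k \<le> dyad m + L \<and> dyad m \<le> dyad k + L) \<Longrightarrow> cmod (t k m) \<le> V * q ^ (k + m)"
proof -
  obtain V M s where *: "V \<ge> 0" "M \<ge> 1" "0 < s" "s < 1"
    "\<And>k m. cmod (t k m) \<le> V * M ^ m * s ^ k" "\<And>k m. cmod (t k m) \<le> V * M ^ k * s ^ m"
    using assms unfolding off_diagonal_decay_def by metis
  obtain D where D: "s ^ D < 1 / M"
    using real_arch_pow_inv[of "1/M" s] * by auto
  then have D': "M * s ^ D \<le> 1" using * by (simp add: field_simps)
  define q where "q = sqrt s"
  have q: "0 < q" "q < 1" "q\<^sup>2 = s" using * by (auto simp: q_def)
  define L where "L = 2 * D + 1"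
  have L: "2 * D + 1 \<le> 2 ^ L" unfolding L_def by (rule less_imp_le[OF less_exp])
  have est: "M ^ m * s ^ k \<le> q ^ (k + m)" if "(2 ^ L) * m \<le> k" for k m
  proof -
    have le: "(2 * D + 1) * m \<le> k" using that mult_right_mono[OF L, of m] by linarith
    then have Dm: "D * m \<le> k" by (auto simp: algebra_simps)
    have "M ^ m * s ^ k = (M * s ^ D) ^ m * s ^ (k - D * m)"
      using Dm by (simp add: power_mult_distrib power_mult [symmetric] mult.assoc power_add [symmetric])
    also have "\<dots> \<le> 1 * s ^ (k - D * m)"
      using * D' by (intro mult_right_mono power_le_one) auto
    also have "\<dots> = q ^ (2 * (k - D * m))" by (simp add: q(3) [symmetric] power_mult)
    also have "\<dots> \<le> q ^ (k + m)"
      using q le by (intro power_decreasing) (auto simp: algebra_simps)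
    finally show ?thesis .
  qed
  show thesis
  proof (rule that[of V q L])
    fix k m assume "\<not> (dyad k \<le> dyad m + L \<and> dyad m \<le> dyad k + L)"
    then consider "dyad m + L < dyad k" | "dyad k + L < dyad m" by linarith
    then show "cmod (t k m) \<le> V * q ^ (k + m)"
    proof cases
      case 1
      have "cmod (t k m) \<le> V * (M ^ m * s ^ k)" using *(5)[of k m] by (simp add: mult.assoc)
      also have "\<dots> \<le> V * q ^ (k + m)" using * by (intro mult_left_mono est dyadic_far 1)
      finally show ?thesis .
    next
      case 2
      have "cmod (t k m) \<le> V * (M ^ k * s ^ m)" using *(6)[of k m] by (simp add: mult.assoc)
      also have "\<dots> \<le> V * q ^ (m + k)" using * by (intro mult_left_mono est dyadic_far 2)
      finally show ?thesis by (simp add: add.commute)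
    qed
  qed (use * q in auto)
qed

text \<open>
  The matrix is split into the part \<open>N\<close> between dyadic blocks at distance at most \<open>L\<close> and the
  remainder \<open>F\<close>. The entries of \<open>F\<close> are so small that \<open>F\<close> is a Hilbert-Schmidt matrix for every weight.
  Within one block of rows, \<open>N\<close> is the given \<open>\<ell>\<^sup>2\<close>-bounded matrix applied to the neighbouring
  blocks of columns, and there the weight is constant up to a factor. Summing over the blocks
  costs only a factor \<open>2 L + 1\<close>, because each column belongs to at most that many neighbourhoods. A Schur
  test on absolute values would not suffice: near the diagonal the boundedness on \<open>\<ell>\<^sup>2\<close> may be due
  to cancellation.
\<close>

theorem off_diagonal_decay_section_bounded:
  assumes bd: "section_bounded 0 t A" and dec: "off_diagonal_decay t"
  obtains C where "section_bounded \<alpha> t C"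
proof -
  obtain L V q where V: "V \<ge> 0" and q: "0 < q" "q < 1" and far:
    "\<And>k m. \<not> (dyad k \<le> dyad m + L \<and> dyad m \<le> dyad k + L) \<Longrightarrow> cmod (t k m) \<le> V * q ^ (k + m)"
    by (rule off_diagonal_decay_far[OF dec], rule that)
  define near where "near i m \<longleftrightarrow> i \<le> dyad m + L \<and> dyad m \<le> i + L" for i m
  define Q where "Q \<beta> = (\<Sum>k. weight \<beta> k * (q\<^sup>2) ^ k)" for \<beta>
  have q2: "q\<^sup>2 < 1" "0 \<le> q\<^sup>2" using q by (auto simp: abs_square_less_1)
  have Qs: "summable (\<lambda>k. weight \<beta> k * (q\<^sup>2) ^ k)" for \<beta>
    by (rule summable_weight_power) (use q2 in auto)
  have Q: "(\<Sum>k<K. weight \<beta> k * (q\<^sup>2) ^ k) \<le> Q \<beta>" "Q \<beta> \<ge> 0" for \<beta> K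
    unfolding Q_def using q by (auto intro!: sum_le_suminf suminf_nonneg Qs)
  have A: "A \<ge> 0" using bd by (simp add: section_bounded_def)
  define c where "c = (2 ^ (0 + 1)) powr \<bar>\<alpha>\<bar>"
  define cL where "cL = (2 ^ (L + 1)) powr \<bar>\<alpha>\<bar>"
  have cs: "c \<ge> 0" "cL \<ge> 0" by (auto simp: c_def cL_def)
  define C where "C = 2 * (c * A * cL * (2 * L + 1)) + 2 * (V\<^sup>2 * Q \<alpha> * Q (-\<alpha>))"
  have "section_bounded \<alpha> t C" unfolding section_bounded_def
  proof (intro conjI allI)
    show "0 \<le> C" unfolding C_def using cs A V Q(2) by (intro add_nonneg_nonneg mult_nonneg_nonneg) auto
    fix K M :: nat and a :: "nat \<Rightarrow> complex"
    define S where "S = (\<Sum>m<M. (cmod (a m))\<^sup>2 * weight \<alpha> m)"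
    have S: "S \<ge> 0" by (auto simp: S_def intro: sum_nonneg)
    define b where "b i m = (if near i m then a m else 0)" for i m
    define N where "N k = (\<Sum>m<M. t k m * b (dyad k) m)" for k
    define F where "F k = (\<Sum>m<M. if near (dyad k) m then 0 else t k m * a m)" for k
    have split: "(\<Sum>m<M. t k m * a m) = N k + F k" for k
      by (auto simp: N_def F_def b_def sum.distrib [symmetric] intro: sum.cong)
    have "(\<Sum>k<K. (cmod (F k))\<^sup>2 * weight \<alpha> k) \<le> (\<Sum>k<K. (V\<^sup>2 * Q (-\<alpha>) * S) * (weight \<alpha> k * (q\<^sup>2) ^ k))"
    proof (rule sum_mono)
      fix k
      have "cmod (F k) \<le> (\<Sum>m<M. V * q ^ k * (q ^ m * cmod (a m)))"
        unfolding F_def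
      proof (rule order_trans[OF norm_sum], rule sum_mono)
        fix m
        show "cmod (if near (dyad k) m then 0 else t k m * a m) \<le> V * q ^ k * (q ^ m * cmod (a m))"
        proof (cases "near (dyad k) m")
          case True
          then show ?thesis using V q by auto
        next
          case False
          then have "cmod (t k m) * cmod (a m) \<le> V * q ^ (k + m) * cmod (a m)"
            by (intro mult_right_mono far) (auto simp: near_def)
          then show ?thesis using False by (simp add: norm_mult power_add mult_ac)
        qed
      qed
      also have "\<dots> = V * q ^ k * (\<Sum>m<M. cmod (a m * of_real q ^ m))"
        using q by (simp add: sum_distrib_left norm_mult norm_power mult_ac)
      finally have "(cmod (F k))\<^sup>2 \<le> (V * q ^ k * (\<Sum>m<M. cmod (a m * of_real q ^ m)))\<^sup>2"
        by (intro power_mono) auto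
      also have "\<dots> = V\<^sup>2 * (q\<^sup>2) ^ k * (\<Sum>m<M. cmod (a m * of_real q ^ m))\<^sup>2"
        by (simp add: power_mult_distrib power_mult [symmetric] mult.commute)
      also have "\<dots> \<le> V\<^sup>2 * (q\<^sup>2) ^ k * (S * Q (-\<alpha>))"
        using power_series_sum_bound[of "of_real q" "{..<M}" a \<alpha>] q
        by (intro mult_left_mono) (auto simp: S_def Q_def)
      finally have "(cmod (F k))\<^sup>2 * weight \<alpha> k \<le> (V\<^sup>2 * (q\<^sup>2) ^ k * (S * Q (-\<alpha>))) * weight \<alpha> k"
        by (intro mult_right_mono) auto
      then show "(cmod (F k))\<^sup>2 * weight \<alpha> k \<le> (V\<^sup>2 * Q (-\<alpha>) * S) * (weight \<alpha> k * (q\<^sup>2) ^ k)"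
        by (simp add: mult_ac)
    qed
    also have "\<dots> \<le> (V\<^sup>2 * Q (-\<alpha>) * S) * Q \<alpha>"
      unfolding sum_distrib_left [symmetric] using V S Q by (intro mult_left_mono) auto
    finally have F: "(\<Sum>k<K. (cmod (F k))\<^sup>2 * weight \<alpha> k) \<le> V\<^sup>2 * Q \<alpha> * Q (-\<alpha>) * S"
      by (simp add: mult_ac)
    \<comment> \<open>The first index of a block represents the weight of the whole block.\<close>
    define W where "W i = weight \<alpha> (2 ^ i - 1)" for i
    have dyW: "dyad (2 ^ i - 1) = i" for i :: nat
      by (simp add: Suc_diff_1)
    \<comment> \<open>Since dyad k is at most k, the blocks numbered below K cover all rows below K.\<close>
    have "(\<Sum>k<K. (cmod (N k))\<^sup>2 * weight \<alpha> k) = (\<Sum>i<K. \<Sum>k\<in>{k\<in>{..<K}. dyad k = i}. (cmod (N k))\<^sup>2 * weight \<alpha> k)"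
    proof (rule sum.group [symmetric])
      show "dyad ` {..<K} \<subseteq> {..<K}"
      proof
        fix i assume "i \<in> dyad ` {..<K}"
        then obtain k where k: "k < K" "i = dyad k" by auto
        have "2 ^ dyad k \<le> Suc k" by (rule floor_log_exp2_le) simp
        moreover have "dyad k < 2 ^ dyad k" by (rule less_exp)
        ultimately show "i \<in> {..<K}" using k unfolding lessThan_iff by linarith
      qed
    qed auto
    also have "\<dots> \<le> (\<Sum>i<K. c * W i * A * (\<Sum>m<M. (cmod (b i m))\<^sup>2))"
    proof (rule sum_mono)
      fix i
      have "(\<Sum>k\<in>{k\<in>{..<K}. dyad k = i}. (cmod (N k))\<^sup>2 * weight \<alpha> k)
        \<le> (\<Sum>k\<in>{k\<in>{..<K}. dyad k = i}. (cmod (\<Sum>m<M. t k m * b i m))\<^sup>2 * (c * W i))"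
        unfolding N_def c_def W_def by (intro sum_mono mult_mono weight_dyadic) (auto simp del: powr_power simp: dyW)
      also have "\<dots> \<le> (\<Sum>k<K. (cmod (\<Sum>m<M. t k m * b i m))\<^sup>2 * (c * W i))"
        by (intro sum_mono2) (auto simp: c_def W_def)
      also have "\<dots> = c * W i * (\<Sum>k<K. (cmod (\<Sum>m<M. t k m * b i m))\<^sup>2)"
        by (simp add: sum_distrib_left mult_ac)
      also have "\<dots> \<le> c * W i * (A * (\<Sum>m<M. (cmod (b i m))\<^sup>2))"
        using bd by (intro mult_left_mono) (auto simp: section_bounded_def c_def W_def)
      finally show "(\<Sum>k\<in>{k\<in>{..<K}. dyad k = i}. (cmod (N k))\<^sup>2 * weight \<alpha> k) \<le> c * W i * A * (\<Sum>m<M. (cmod (b i m))\<^sup>2)"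
        by (simp add: mult_ac)
    qed
    also have "\<dots> = (\<Sum>m<M. \<Sum>i<K. c * A * (W i * (cmod (b i m))\<^sup>2))"
      unfolding sum_distrib_left by (subst sum.swap) (simp add: mult_ac)
    also have "\<dots> \<le> (\<Sum>m<M. c * A * (cL * (2 * L + 1)) * ((cmod (a m))\<^sup>2 * weight \<alpha> m))"
    proof (rule sum_mono)
      fix m
      have "(\<Sum>i<K. W i * (cmod (b i m))\<^sup>2) = (\<Sum>i\<in>{i\<in>{..<K}. near i m}. W i * (cmod (a m))\<^sup>2)"
        by (rule sum.mono_neutral_cong_right) (auto simp: b_def)
      also have "\<dots> \<le> (\<Sum>i\<in>{i\<in>{..<K}. near i m}. (cL * weight \<alpha> m) * (cmod (a m))\<^sup>2)"
        unfolding cL_def W_def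
        by (intro sum_mono mult_right_mono weight_dyadic) (auto simp: near_def dyW)
      also have "\<dots> = real (card {i\<in>{..<K}. near i m}) * (cL * weight \<alpha> m * (cmod (a m))\<^sup>2)" by simp
      also have "\<dots> \<le> real (2 * L + 1) * (cL * weight \<alpha> m * (cmod (a m))\<^sup>2)"
      proof (intro mult_right_mono)
        have "{i\<in>{..<K}. near i m} \<subseteq> {dyad m - L..dyad m + L}" by (auto simp: near_def)
        then have "card {i\<in>{..<K}. near i m} \<le> card {dyad m - L..dyad m + L}" by (intro card_mono) auto
        also have "\<dots> \<le> 2 * L + 1" by auto
        finally show "real (card {i\<in>{..<K}. near i m}) \<le> real (2 * L + 1)" by linarith
      qed (use cs in auto)
      finally have "(c * A) * (\<Sum>i<K. W i * (cmod (b i m))\<^sup>2) \<le> (c * A) * (real (2 * L + 1) * (cL * weight \<alpha> m * (cmod (a m))\<^sup>2))"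
        using cs A by (intro mult_left_mono) auto
      then show "(\<Sum>i<K. c * A * (W i * (cmod (b i m))\<^sup>2)) \<le> c * A * (cL * (2 * L + 1)) * ((cmod (a m))\<^sup>2 * weight \<alpha> m)"
        by (simp add: sum_distrib_left mult_ac)
    qed
    also have "\<dots> = (c * A * cL * (2 * L + 1)) * S"
      by (simp add: S_def sum_distrib_left mult_ac)
    finally have N: "(\<Sum>k<K. (cmod (N k))\<^sup>2 * weight \<alpha> k) \<le> (c * A * cL * (2 * L + 1)) * S" .
    have "(\<Sum>k<K. (cmod (\<Sum>m<M. t k m * a m))\<^sup>2 * weight \<alpha> k)
      \<le> (\<Sum>k<K. (2 * (cmod (N k))\<^sup>2 + 2 * (cmod (F k))\<^sup>2) * weight \<alpha> k)"
      unfolding split by (intro sum_mono mult_right_mono square_norm_add_le) auto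
    also have "\<dots> = 2 * (\<Sum>k<K. (cmod (N k))\<^sup>2 * weight \<alpha> k) + 2 * (\<Sum>k<K. (cmod (F k))\<^sup>2 * weight \<alpha> k)"
      by (simp add: sum_distrib_left sum.distrib [symmetric] algebra_simps)
    also have "\<dots> \<le> C * S" using N F by (simp add: C_def algebra_simps)
    finally show "(\<Sum>k<K. (cmod (\<Sum>m<M. t k m * a m))\<^sup>2 * weight \<alpha> k) \<le> C * (\<Sum>m<M. (cmod (a m))\<^sup>2 * weight \<alpha> m)"
      by (simp add: S_def)
  qed
  then show thesis by (rule that)
qed

section \<open>Coefficients of analytic functions\<close>

lemma coef_sums:
  assumes "f holomorphic_on ball 0 1" "cmod z < 1"
  shows "(\<lambda>k. coef f k * z ^ k) sums f z"
  using holomorphic_power_series[OF assms(1), of z] assms(2)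
  by (simp add: coef_def fps_expansion_def)

lemma coef_eqI:
  assumes "\<And>z. cmod z < 1 \<Longrightarrow> (\<lambda>k. c k * z ^ k) sums f z"
  shows "coef f = c"
proof -
  have "f has_fps_expansion Abs_fps c"
  proof (rule has_fps_expansionI)
    have "eventually (\<lambda>z. z \<in> ball 0 1) (nhds (0::complex))"
      by (intro eventually_nhds_in_open) auto
    then show "eventually (\<lambda>u. (\<lambda>n. fps_nth (Abs_fps c) n * u ^ n) sums f u) (nhds 0)"
      by eventually_elim (use assms in auto)
  qed
  then have "fps_expansion f 0 = Abs_fps c" by (rule fps_expansion_eqI)
  then show ?thesis by (simp add: coef_def fun_eq_iff)
qed

lemma coef_cong:
  assumes "f holomorphic_on ball 0 1" "\<And>z. cmod z < 1 \<Longrightarrow> f z = g z"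
  shows "coef g = coef f"
  by (rule coef_eqI) (use coef_sums[OF assms(1)] assms(2) in auto)

lemma coef_bound:
  assumes "f holomorphic_on ball 0 R" "0 < r" "r < R" "\<And>z. cmod z = r \<Longrightarrow> cmod (f z) \<le> C"
  shows "cmod (coef f k) \<le> C / r ^ k"
proof -
  have sub: "cball 0 r \<subseteq> ball (0::complex) R" using assms by auto
  have "cmod ((deriv ^^ k) f 0) \<le> fact k * C / r ^ k"
  proof (rule Cauchy_inequality)
    show "f holomorphic_on ball 0 r" using assms by (auto intro: holomorphic_on_subset)
    show "continuous_on (cball 0 r) f"
      by (intro holomorphic_on_imp_continuous_on holomorphic_on_subset[OF assms(1) sub])
  qed (use assms in auto)
  then show ?thesis
    by (simp add: coef_def fps_expansion_def norm_divide field_simps)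
qed

lemma disc_analyticI:
  assumes "\<And>z. cmod z < 1 \<Longrightarrow> (\<lambda>k. c k * z ^ k) sums f z" "\<And>z. 1 \<le> cmod z \<Longrightarrow> f z = 0"
  shows "f \<in> disc_analytic"
proof -
  have "f holomorphic_on ball 0 1"
    by (rule power_series_holomorphic[where a = c]) (use assms in auto)
  then show ?thesis using assms(2) by (auto simp: disc_analytic_def)
qed

lemma disc_analytic_holo: "f \<in> disc_analytic \<Longrightarrow> f holomorphic_on ball 0 1"
  by (simp add: disc_analytic_def)

lemma disc_analytic_outside: "f \<in> disc_analytic \<Longrightarrow> \<not> cmod z < 1 \<Longrightarrow> f z = 0"
  by (simp add: disc_analytic_def)

lemma disc_analytic_eqI:
  assumes "f \<in> disc_analytic" "g \<in> disc_analytic" "\<And>z. cmod z < 1 \<Longrightarrow> f z = g z"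
  shows "f = g"
proof
  fix z
  show "f z = g z"
    using assms(3)[of z] disc_analytic_outside[OF assms(1), of z] disc_analytic_outside[OF assms(2), of z]
    by (cases "cmod z < 1") auto
qed

lemma A_space_iff: "f \<in> A_space \<alpha> \<longleftrightarrow> f \<in> disc_analytic \<and> coef f \<in> weighted_l2 \<alpha>"
  by (simp add: A_space_def weighted_l2_def weight_def)

lemma A_norm_eq: "A_norm \<alpha> f = sqrt (sqnorm \<alpha> (coef f))"
  by (simp add: A_norm_def sqnorm_def weight_def)

text \<open>
  A function that has a power series with coefficients in the weighted space belongs to \<open>A_space\<close>;
  holomorphy need not be known in advance.
\<close>

lemma A_spaceI:
  assumes "a \<in> weighted_l2 \<alpha>" "\<And>z. cmod z < 1 \<Longrightarrow> f z = (\<Sum>k. a k * z ^ k)" "\<And>z. 1 \<le> cmod z \<Longrightarrow> f z = 0"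
  shows "f \<in> A_space \<alpha>" "coef f = a"
proof -
  have s: "(\<lambda>k. a k * z ^ k) sums f z" if "cmod z < 1" for z
    using summable_norm_cancel[OF weighted_l2_power_series_summable(1)[OF assms(1) that]] assms(2)[OF that]
    by (simp add: sums_iff)
  show c: "coef f = a" by (rule coef_eqI) (rule s)
  show "f \<in> A_space \<alpha>"
    using disc_analyticI[OF s assms(3)] assms(1) c by (simp add: A_space_iff)
qed

lemma A_space_series:
  assumes "f \<in> A_space \<alpha>" "cmod z < 1"
  shows "f z = (\<Sum>k. coef f k * z ^ k)"
  using coef_sums[of f z] assms by (simp add: A_space_iff disc_analytic_def sums_iff)

definition disc_series :: "(nat \<Rightarrow> complex) \<Rightarrow> complex \<Rightarrow> complex" where
  "disc_series a z = (if cmod z < 1 then (\<Sum>k. a k * z ^ k) else 0)"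

lemma disc_series_in_A_space: "a \<in> weighted_l2 \<alpha> \<Longrightarrow> disc_series a \<in> A_space \<alpha>"
  and coef_disc_series: "a \<in> weighted_l2 \<alpha> \<Longrightarrow> coef (disc_series a) = a"
  by (rule A_spaceI[of a \<alpha>]; auto simp: disc_series_def)+

lemma coef_add:
  assumes "f holomorphic_on ball 0 1" "g holomorphic_on ball 0 1"
  shows "coef (f + g) k = coef f k + coef g k"
proof -
  have "coef (f + g) = (\<lambda>k. coef f k + coef g k)"
    by (rule coef_eqI) (use sums_add[OF coef_sums[OF assms(1)] coef_sums[OF assms(2)]] in \<open>simp add: algebra_simps\<close>)
  then show ?thesis by simp
qed

lemma coef_fscale:
  assumes "f holomorphic_on ball 0 1"
  shows "coef (fscale c f) k = c * coef f k"
proof -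
  have "coef (fscale c f) = (\<lambda>k. c * coef f k)"
    by (rule coef_eqI) (use sums_mult[OF coef_sums[OF assms(1)]] in \<open>simp add: fscale_def mult.assoc\<close>)
  then show ?thesis by simp
qed

lemma coef_mult:
  assumes "f holomorphic_on ball 0 1" "g holomorphic_on ball 0 1"
  shows "coef (f * g) k = (\<Sum>i\<le>k. coef f i * coef g (k - i))"
proof -
  have "f has_fps_expansion fps_expansion f 0" "g has_fps_expansion fps_expansion g 0"
    by (rule has_fps_expansion_fps_expansion[of "ball 0 1"]; use assms in simp)+
  then have "(\<lambda>x. f x * g x) has_fps_expansion fps_expansion f 0 * fps_expansion g 0"
    by (rule has_fps_expansion_mult)
  then have "fps_expansion (f * g) 0 = fps_expansion f 0 * fps_expansion g 0"
    unfolding times_fun_def by (rule fps_expansion_eqI)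
  then show ?thesis by (simp add: coef_def fps_mult_nth atLeast0AtMost)
qed

lemma disc_analytic_add: "f \<in> disc_analytic \<Longrightarrow> g \<in> disc_analytic \<Longrightarrow> f + g \<in> disc_analytic"
  by (auto simp: disc_analytic_def plus_fun_def intro: holomorphic_intros)

lemma disc_analytic_fscale: "f \<in> disc_analytic \<Longrightarrow> fscale c f \<in> disc_analytic"
  by (auto simp: disc_analytic_def fscale_def intro: holomorphic_intros)

lemma disc_analytic_mult: "u holomorphic_on ball 0 1 \<Longrightarrow> f \<in> disc_analytic \<Longrightarrow> u * f \<in> disc_analytic"
  by (auto simp: disc_analytic_def times_fun_def intro: holomorphic_intros)

lemma A_space_holo: "f \<in> A_space \<alpha> \<Longrightarrow> f holomorphic_on ball 0 1"
  by (simp add: A_space_iff disc_analytic_def)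

lemma A_space_add: "f \<in> A_space \<alpha> \<Longrightarrow> g \<in> A_space \<alpha> \<Longrightarrow> f + g \<in> A_space \<alpha>"
  using weighted_l2_add[of "coef f" \<alpha> "coef g"]
  by (simp add: A_space_iff disc_analytic_add coef_add ext[OF coef_add] disc_analytic_holo)

lemma A_space_fscale: "f \<in> A_space \<alpha> \<Longrightarrow> fscale c f \<in> A_space \<alpha>"
  using weighted_l2_cmult[of "coef f" \<alpha> c]
  by (simp add: A_space_iff disc_analytic_fscale ext[OF coef_fscale] disc_analytic_holo)

lemma A_space_0: "0 \<in> A_space \<alpha>"
proof -
  have z: "(0::complex \<Rightarrow> complex) \<in> disc_analytic" by (auto simp: disc_analytic_def zero_fun_def)
  have "coef (0::complex \<Rightarrow> complex) = (\<lambda>k. 0)" by (rule coef_eqI) simp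
  with z show ?thesis by (simp add: A_space_iff weighted_l2_def)
qed

lemma A_space_sum: "(\<And>i. i \<in> I \<Longrightarrow> f i \<in> A_space \<alpha>) \<Longrightarrow> (\<Sum>i\<in>I. f i) \<in> A_space \<alpha>"
  by (induction I rule: infinite_finite_induct) (auto simp: A_space_0 A_space_add)

lemma fun_diff_eq: "f - g = f + fscale (-1) g"
  by (simp add: fun_eq_iff fscale_def)

lemma A_space_diff: "f \<in> A_space \<alpha> \<Longrightarrow> g \<in> A_space \<alpha> \<Longrightarrow> f - g \<in> A_space \<alpha>"
  unfolding fun_diff_eq by (intro A_space_add A_space_fscale)

lemma coef_diff:
  assumes "f holomorphic_on ball 0 1" "g holomorphic_on ball 0 1"
  shows "coef (f - g) k = coef f k - coef g k"
proof -
  have "coef (f - g) = (\<lambda>k. coef f k - coef g k)"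
    by (rule coef_eqI) (use sums_diff[OF coef_sums[OF assms(1)] coef_sums[OF assms(2)]] in \<open>simp add: algebra_simps\<close>)
  then show ?thesis by simp
qed

section \<open>Multiplication by functions holomorphic across the circle\<close>

lemma holo_beyond_coef_decay:
  assumes "u holomorphic_on ball 0 R" "R > 1"
  obtains C s where "C \<ge> 0" "0 < s" "s < 1" "\<And>k. cmod (coef u k) \<le> C * s ^ k"
proof -
  define r where "r = (1 + R) / 2"
  have r: "1 < r" "r < R" using assms by (auto simp: r_def)
  have "continuous_on (sphere 0 r) u"
    using r by (intro holomorphic_on_imp_continuous_on holomorphic_on_subset[OF assms(1)]) auto
  then have "compact (u ` sphere 0 r)" by (intro compact_continuous_image) auto
  then obtain C where C: "\<And>z. cmod z = r \<Longrightarrow> cmod (u z) \<le> C"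
    using compact_imp_bounded[of "u ` sphere 0 r"] unfolding bounded_iff by (metis image_eqI mem_sphere_0)
  have "cmod (u (of_real r)) \<le> C" using C r by simp
  then have "C \<ge> 0" using norm_ge_zero order_trans by blast
  moreover have "cmod (coef u k) \<le> C * (1 / r) ^ k" for k
    using coef_bound[OF assms(1) _ r(2) C, of k] r by (simp add: power_divide)
  ultimately show thesis using r by (intro that[of C "1 / r"]) auto
qed

lemma weight_add_le: "weight \<alpha> (k + j) \<le> weight \<bar>\<alpha>\<bar> j * weight \<alpha> k"
proof -
  have "weight \<alpha> (k + j) \<le> (real (j + 1)) powr \<bar>\<alpha>\<bar> * weight \<alpha> k"
  proof (rule weight_le_ratio)
    show "real (k + j + 1) \<le> real (j + 1) * real (k + 1)" by (simp add: algebra_simps)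
    show "real (k + 1) \<le> real (j + 1) * real (k + j + 1)" by (simp add: algebra_simps)
  qed
  then show ?thesis by (simp add: weight_def)
qed

text \<open>
  A function holomorphic across the circle has exponentially decaying coefficients, while shifting
  by \<open>i\<close> places multiplies the norm by at most a power of \<open>i + 1\<close>. The convolution is estimated by Cauchy-Schwarz with respect to the
  measure \<open>\<bar>u\<^sub>i\<bar>\<close> on the indices.
\<close>

lemma A_space_mult_holo:
  assumes u: "u holomorphic_on ball 0 R" "R > 1" and f: "f \<in> A_space \<alpha>"
  shows "u * f \<in> A_space \<alpha>"
proof -
  have u1: "u holomorphic_on ball 0 1" using u by (auto intro: holomorphic_on_subset)
  obtain C s where C: "C \<ge> 0" "0 < s" "s < 1" "\<And>k. cmod (coef u k) \<le> C * s ^ k"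
    by (rule holo_beyond_coef_decay[OF u], rule that)
  define c where "c k = cmod (coef u k)" for k
  have c: "0 \<le> c k" for k by (simp add: c_def)
  define E where "E = (\<Sum>k. C * s ^ k)"
  define D where "D = (\<Sum>k. C * (weight \<bar>\<alpha>\<bar> k * s ^ k))"
  have sE: "summable (\<lambda>k. C * s ^ k)" and sD: "summable (\<lambda>k. C * (weight \<bar>\<alpha>\<bar> k * s ^ k))"
    using C by (auto intro!: summable_mult summable_geometric summable_weight_power)
  have E: "(\<Sum>k\<le>K. c k) \<le> E" "E \<ge> 0" for K
    using sum_mono[of "{..K}" c "\<lambda>k. C * s ^ k"] sum_le_suminf[OF sE, of "{..K}"] C suminf_nonneg[OF sE]
    by (auto simp: E_def c_def)
  have D: "(\<Sum>k<K. c k * weight \<bar>\<alpha>\<bar> k) \<le> D" "D \<ge> 0" for K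
  proof -
    have "(\<Sum>k<K. c k * weight \<bar>\<alpha>\<bar> k) \<le> (\<Sum>k<K. C * (weight \<bar>\<alpha>\<bar> k * s ^ k))"
      unfolding c_def using mult_right_mono[OF C(4) weight_nonneg]
      by (intro sum_mono) (simp add: mult_ac)
    also have "\<dots> \<le> D" unfolding D_def using C by (intro sum_le_suminf[OF sD]) auto
    finally show "(\<Sum>k<K. c k * weight \<bar>\<alpha>\<bar> k) \<le> D" .
    show "D \<ge> 0" unfolding D_def using C by (intro suminf_nonneg[OF sD]) auto
  qed
  let ?a = "coef f"
  have a: "?a \<in> weighted_l2 \<alpha>" using f by (simp add: A_space_iff)
  have "coef (u * f) \<in> weighted_l2 \<alpha>"
  proof (rule weighted_l2I_bounded)
    fix K
    have pt: "(cmod (coef (u * f) k))\<^sup>2 * weight \<alpha> k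
        \<le> E * (\<Sum>i\<le>k. (c i * weight \<bar>\<alpha>\<bar> i) * ((cmod (?a (k - i)))\<^sup>2 * weight \<alpha> (k - i)))" for k
    proof -
      have "cmod (coef (u * f) k) \<le> (\<Sum>i\<le>k. sqrt (c i) * (sqrt (c i) * cmod (?a (k - i))))"
        unfolding coef_mult[OF u1 A_space_holo[OF f]]
        by (rule order_trans[OF norm_sum]) (simp add: norm_mult c_def mult.assoc[symmetric])
      then have "(cmod (coef (u * f) k))\<^sup>2 \<le> (\<Sum>i\<le>k. sqrt (c i) * (sqrt (c i) * cmod (?a (k - i))))\<^sup>2"
        by (intro power_mono) auto
      also have "\<dots> \<le> (\<Sum>i\<le>k. (sqrt (c i))\<^sup>2) * (\<Sum>i\<le>k. (sqrt (c i) * cmod (?a (k - i)))\<^sup>2)"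
        by (rule Cauchy_Schwarz_ineq_sum)
      also have "\<dots> = (\<Sum>i\<le>k. c i) * (\<Sum>i\<le>k. c i * (cmod (?a (k - i)))\<^sup>2)"
        by (simp add: c power_mult_distrib)
      also have "\<dots> \<le> E * (\<Sum>i\<le>k. c i * (cmod (?a (k - i)))\<^sup>2)"
        by (intro mult_right_mono E sum_nonneg) (auto simp: c)
      finally have "(cmod (coef (u * f) k))\<^sup>2 * weight \<alpha> k \<le> E * (\<Sum>i\<le>k. c i * (cmod (?a (k - i)))\<^sup>2) * weight \<alpha> k"
        by (intro mult_right_mono) auto
      also have "\<dots> = E * (\<Sum>i\<le>k. c i * (cmod (?a (k - i)))\<^sup>2 * weight \<alpha> k)"
        by (simp only: sum_distrib_right mult.assoc)
      also have "\<dots> \<le> E * (\<Sum>i\<le>k. (c i * (cmod (?a (k - i)))\<^sup>2) * (weight \<bar>\<alpha>\<bar> i * weight \<alpha> (k - i)))"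
      proof (intro mult_left_mono sum_mono E)
        fix i assume "i \<in> {..k}"
        then show "weight \<alpha> k \<le> weight \<bar>\<alpha>\<bar> i * weight \<alpha> (k - i)" using weight_add_le[of \<alpha> "k - i" i] by simp
      qed (auto simp: c)
      finally show ?thesis by (simp add: mult_ac)
    qed
    have "(\<Sum>k<K. (cmod (coef (u * f) k))\<^sup>2 * weight \<alpha> k)
      \<le> (\<Sum>k<K. E * (\<Sum>i\<le>k. (c i * weight \<bar>\<alpha>\<bar> i) * ((cmod (?a (k - i)))\<^sup>2 * weight \<alpha> (k - i))))"
      by (intro sum_mono pt)
    also have "\<dots> = E * (\<Sum>k<K. \<Sum>i\<le>k. (c i * weight \<bar>\<alpha>\<bar> i) * ((cmod (?a (k - i)))\<^sup>2 * weight \<alpha> (k - i)))"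
      by (simp only: sum_distrib_left)
    finally have le: "(\<Sum>k<K. (cmod (coef (u * f) k))\<^sup>2 * weight \<alpha> k) \<le> \<dots>" .
    have "(\<Sum>k<K. \<Sum>i\<le>k. (c i * weight \<bar>\<alpha>\<bar> i) * ((cmod (?a (k - i)))\<^sup>2 * weight \<alpha> (k - i)))
      = (\<Sum>(i,j)\<in>{(i,j). i + j < K}. (c i * weight \<bar>\<alpha>\<bar> i) * ((cmod (?a j))\<^sup>2 * weight \<alpha> j))"
      by (rule sum.triangle_reindex[symmetric])
    also have "\<dots> \<le> (\<Sum>(i,j)\<in>{..<K} \<times> {..<K}. (c i * weight \<bar>\<alpha>\<bar> i) * ((cmod (?a j))\<^sup>2 * weight \<alpha> j))"
      by (intro sum_mono2) (auto simp: c)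
    also have "\<dots> = (\<Sum>i<K. c i * weight \<bar>\<alpha>\<bar> i) * (\<Sum>j<K. (cmod (?a j))\<^sup>2 * weight \<alpha> j)"
      by (simp add: sum.cartesian_product[symmetric] sum_product)
    also have "\<dots> \<le> D * sqnorm \<alpha> ?a"
      by (intro mult_mono D sum_le_sqnorm a sum_nonneg) auto
    finally have "(\<Sum>k<K. \<Sum>i\<le>k. (c i * weight \<bar>\<alpha>\<bar> i) * ((cmod (?a (k - i)))\<^sup>2 * weight \<alpha> (k - i))) \<le> D * sqnorm \<alpha> ?a" .
    then show "(\<Sum>k<K. (cmod (coef (u * f) k))\<^sup>2 * weight \<alpha> k) \<le> E * (D * sqnorm \<alpha> ?a)"
      using E(2) by (intro order_trans[OF le] mult_left_mono)
  qed
  moreover have "u * f \<in> disc_analytic" using u1 f by (simp add: disc_analytic_mult A_space_iff)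
  ultimately show ?thesis by (simp add: A_space_iff)
qed

section \<open>The Hardy space and Blaschke factors\<close>

lemma Hardy2_inner_summable:
  assumes "f \<in> A_space 0" "g \<in> A_space 0"
  shows "summable (\<lambda>k. coef f k * cnj (coef g k))"
proof (rule summable_comparison_test')
  show "summable (\<lambda>k. (cmod (coef f k))\<^sup>2 + (cmod (coef g k))\<^sup>2)"
    using assms by (intro summable_add) (auto simp: A_space_iff weighted_l2_def)
  fix k
  have "2 * (cmod (coef f k) * cmod (coef g k)) \<le> (cmod (coef f k))\<^sup>2 + (cmod (coef g k))\<^sup>2"
    using zero_le_power2[of "cmod (coef f k) - cmod (coef g k)"]
    by (simp add: power2_eq_square algebra_simps)
  moreover have "0 \<le> cmod (coef f k) * cmod (coef g k)" by simp
  ultimately show "norm (coef f k * cnj (coef g k)) \<le> (cmod (coef f k))\<^sup>2 + (cmod (coef g k))\<^sup>2"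
    unfolding norm_mult complex_mod_cnj by linarith
qed

lemma Hardy2_inner_add_left:
  assumes "f \<in> A_space 0" "g \<in> A_space 0" "h \<in> A_space 0"
  shows "Hardy2_inner (f + g) h = Hardy2_inner f h + Hardy2_inner g h"
  using suminf_add[OF Hardy2_inner_summable Hardy2_inner_summable, OF assms(1,3,2,3)]
  by (simp add: Hardy2_inner_def coef_add[OF A_space_holo[OF assms(1)] A_space_holo[OF assms(2)]] distrib_right)

lemma Hardy2_inner_fscale_left:
  assumes "f \<in> A_space 0" "h \<in> A_space 0"
  shows "Hardy2_inner (fscale c f) h = c * Hardy2_inner f h"
  using suminf_mult[OF Hardy2_inner_summable, OF assms]
  by (simp add: Hardy2_inner_def coef_fscale A_space_holo[OF assms(1)] algebra_simps)

lemma Hardy2_inner_cnj: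
  assumes "f \<in> A_space 0" "g \<in> A_space 0"
  shows "Hardy2_inner g f = cnj (Hardy2_inner f g)"
proof -
  have "(\<lambda>k. cnj (coef f k * cnj (coef g k))) sums cnj (Hardy2_inner f g)"
    unfolding sums_cnj Hardy2_inner_def by (rule summable_sums[OF Hardy2_inner_summable[OF assms]])
  then show ?thesis by (simp add: Hardy2_inner_def sums_iff mult.commute)
qed

lemma Hardy2_inner_add_right:
  assumes "f \<in> A_space 0" "g \<in> A_space 0" "h \<in> A_space 0"
  shows "Hardy2_inner h (f + g) = Hardy2_inner h f + Hardy2_inner h g"
  using arg_cong[OF Hardy2_inner_add_left[OF assms], of cnj]
  unfolding complex_cnj_add
  by (simp only: Hardy2_inner_cnj[OF assms(1,3), symmetric] Hardy2_inner_cnj[OF assms(2,3), symmetric]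
    Hardy2_inner_cnj[OF A_space_add[OF assms(1,2)] assms(3), symmetric])

lemma Hardy2_inner_fscale_right:
  assumes "f \<in> A_space 0" "h \<in> A_space 0"
  shows "Hardy2_inner h (fscale c f) = cnj c * Hardy2_inner h f"
  using arg_cong[OF Hardy2_inner_fscale_left[OF assms, of c], of cnj]
  unfolding complex_cnj_mult
  by (simp only: Hardy2_inner_cnj[OF assms, symmetric]
    Hardy2_inner_cnj[OF A_space_fscale[OF assms(1)] assms(2), symmetric])

lemmas Hardy2_inner_linear = Hardy2_inner_add_left Hardy2_inner_add_right
  Hardy2_inner_fscale_left Hardy2_inner_fscale_right

lemma Hardy2_inner_self:
  assumes "f \<in> A_space 0"
  shows "Hardy2_inner f f = of_real (sqnorm 0 (coef f))"
proof -
  have "(\<lambda>k. (cmod (coef f k))\<^sup>2) sums sqnorm 0 (coef f)"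
    using assms by (simp add: A_space_iff weighted_l2_def sqnorm_def sums_iff)
  then have "(\<lambda>k. complex_of_real ((cmod (coef f k))\<^sup>2)) sums of_real (sqnorm 0 (coef f))"
    by (rule sums_of_real)
  then show ?thesis
    unfolding Hardy2_inner_def complex_norm_square by (simp add: sums_iff)
qed

lemma Hardy2_inner_self_eq_0:
  assumes "f \<in> A_space 0" "Hardy2_inner f f = 0"
  shows "f = 0"
proof -
  have "sqnorm 0 (coef f) = 0" using Hardy2_inner_self[OF assms(1)] assms(2) by simp
  then have "coef f k = 0" for k
    using sum_le_sqnorm[of "coef f" 0 "{k}"] assms(1) by (simp add: A_space_iff)
  then have "f z = 0" for z
    using A_space_series[OF assms(1), of z] disc_analytic_outside[of f z] assms(1)
    by (cases "cmod z < 1") (auto simp: A_space_iff)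
  then show ?thesis by (simp add: fun_eq_iff)
qed

definition shift :: "(complex \<Rightarrow> complex) \<Rightarrow> complex \<Rightarrow> complex" where
  "shift f = (\<lambda>z. z * f z)"

lemma shift_in_A_space: "f \<in> A_space \<alpha> \<Longrightarrow> shift f \<in> A_space \<alpha>"
  using A_space_mult_holo[of "\<lambda>z. z" 2 f \<alpha>] by (simp add: shift_def times_fun_def)

lemma coef_shift:
  assumes "f holomorphic_on ball 0 1"
  shows "coef (shift f) = (\<lambda>k. case k of 0 \<Rightarrow> 0 | Suc k \<Rightarrow> coef f k)"
proof (rule coef_eqI)
  fix z :: complex assume "cmod z < 1"
  then have "(\<lambda>k. z * (coef f k * z ^ k)) sums (z * f z)"
    by (intro sums_mult coef_sums assms)
  then have "(\<lambda>k. (case Suc k of 0 \<Rightarrow> 0 | Suc k \<Rightarrow> coef f k) * z ^ Suc k) sums (z * f z)"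
    by (simp add: mult_ac)
  then show "(\<lambda>k. (case k of 0 \<Rightarrow> 0 | Suc k \<Rightarrow> coef f k) * z ^ k) sums shift f z"
    by (subst (asm) sums_Suc_iff) (simp add: shift_def)
qed

lemma Hardy2_inner_shift_right:
  assumes "f \<in> A_space 0" "g \<in> A_space 0"
  shows "Hardy2_inner f (shift g) = (\<Sum>k. coef f (Suc k) * cnj (coef g k))"
  unfolding Hardy2_inner_def
  using suminf_split_head[OF Hardy2_inner_summable[OF assms(1) shift_in_A_space[OF assms(2)]]]
  by (simp add: coef_shift[OF A_space_holo[OF assms(2)]])

lemma Hardy2_inner_shift:
  assumes "f \<in> A_space 0" "g \<in> A_space 0"
  shows "Hardy2_inner (shift f) (shift g) = Hardy2_inner f g"
  unfolding Hardy2_inner_shift_right[OF shift_in_A_space[OF assms(1)] assms(2)]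
  by (simp add: coef_shift[OF A_space_holo[OF assms(1)]] Hardy2_inner_def)

text \<open>
  On the circle \<open>\<bar>z - a\<bar> = \<bar>1 - cnj a z\<bar>\<close>. Algebraically, both sides expand to the same four terms
  because the shift is an isometry, so boundary values are never needed.
\<close>

lemma Hardy2_inner_factor:
  assumes g: "g \<in> A_space 0" "h \<in> A_space 0"
  shows "Hardy2_inner (\<lambda>z. (z - a) * g z) (\<lambda>z. (z - a) * h z)
    = Hardy2_inner (\<lambda>z. (1 - cnj a * z) * g z) (\<lambda>z. (1 - cnj a * z) * h z)"
proof -
  define c where "c = - a"
  have e1: "(\<lambda>z. (z - a) * g z) = shift g + fscale c g" for g
    by (simp add: fun_eq_iff shift_def fscale_def c_def algebra_simps)
  have e2: "(\<lambda>z. (1 - cnj a * z) * g z) = g + fscale (cnj c) (shift g)" for g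
    by (simp add: fun_eq_iff shift_def fscale_def c_def algebra_simps)
  show ?thesis
    unfolding e1 e2 using g
    by (simp add: Hardy2_inner_linear shift_in_A_space A_space_fscale A_space_add Hardy2_inner_shift algebra_simps)
qed

lemma one_minus_cnj_mult_nonzero:
  assumes "R * cmod a < 1" "cmod z < R"
  shows "1 - cnj a * z \<noteq> 0"
proof
  assume "1 - cnj a * z = 0"
  then have "cnj a * z = 1" by simp
  then have "cmod a * cmod z = 1" by (metis complex_mod_cnj norm_mult norm_one)
  moreover have "cmod a * cmod z \<le> cmod a * R" using assms by (intro mult_left_mono) auto
  ultimately show False using assms by (simp add: mult.commute)
qed

definition blaschke_factor :: "complex \<Rightarrow> complex \<Rightarrow> complex" where
  "blaschke_factor a z = (z - a) / (1 - cnj a * z)"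

lemma blaschke_factor_holo: "R * cmod a < 1 \<Longrightarrow> blaschke_factor a holomorphic_on ball 0 R"
  unfolding blaschke_factor_def[abs_def] by (intro holomorphic_intros) (use one_minus_cnj_mult_nonzero in auto)

text \<open>
  Apply the preceding identity to \<open>f\<close> and \<open>g\<close> divided by \<open>1 - cnj a z\<close>.
\<close>

lemma Hardy2_inner_blaschke_factor:
  assumes R: "R > 1" "R * cmod a < 1" and f: "f \<in> A_space 0" "g \<in> A_space 0"
  shows "Hardy2_inner (blaschke_factor a * f) (blaschke_factor a * g) = Hardy2_inner f g"
proof -
  define q where "q z = inverse (1 - cnj a * z)" for z
  have q: "q holomorphic_on ball 0 R"
    unfolding q_def[abs_def] by (intro holomorphic_intros) (use one_minus_cnj_mult_nonzero R in auto)
  have q1: "(1 - cnj a * z) * q z = 1" if "cmod z < 1" for z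
    using one_minus_cnj_mult_nonzero[OF R(2), of z] that R by (simp add: q_def)
  have e1: "blaschke_factor a * f = (\<lambda>z. (z - a) * (q * f) z)" for f
    by (simp add: fun_eq_iff blaschke_factor_def q_def divide_inverse mult_ac)
  have e2: "(\<lambda>z. (1 - cnj a * z) * (q * f) z) = f" if f: "f \<in> A_space 0" for f
  proof
    fix z
    show "(1 - cnj a * z) * (q * f) z = f z"
      using q1[of z] disc_analytic_outside[of f z] f
      by (cases "cmod z < 1") (auto simp: A_space_iff mult.assoc[symmetric])
  qed
  have "q * f \<in> A_space 0" "q * g \<in> A_space 0"
    by (intro A_space_mult_holo[OF q R(1)] f)+
  from Hardy2_inner_factor[OF this, of a] show ?thesis
    unfolding e1 [symmetric] e2[OF f(1)] e2[OF f(2)] .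
qed

lemma blaschke_factor_norm_less:
  assumes "cmod a < 1" "cmod z < 1"
  shows "cmod (blaschke_factor a z) < 1"
proof -
  have nz: "1 - cnj a * z \<noteq> 0" by (rule one_minus_cnj_mult_nonzero[of 1]) (use assms in auto)
  \<comment> \<open>The identity behind the invariance of the pseudohyperbolic distance.\<close>
  have "(cmod (1 - cnj a * z))\<^sup>2 - (cmod (z - a))\<^sup>2 = (1 - (cmod a)\<^sup>2) * (1 - (cmod z)\<^sup>2)"
  proof -
    have "complex_of_real ((cmod (1 - cnj a * z))\<^sup>2 - (cmod (z - a))\<^sup>2) = of_real ((1 - (cmod a)\<^sup>2) * (1 - (cmod z)\<^sup>2))"
      unfolding of_real_diff of_real_mult complex_norm_square by (simp add: algebra_simps)
    then show ?thesis by (simp only: of_real_eq_iff)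
  qed
  moreover have "\<dots> > 0" using assms by (intro mult_pos_pos) (auto simp: abs_square_less_1)
  ultimately have "(cmod (z - a))\<^sup>2 < (cmod (1 - cnj a * z))\<^sup>2" by linarith
  then have "cmod (z - a) < cmod (1 - cnj a * z)" by (rule power2_less_imp_less) simp
  then show ?thesis using nz by (simp add: blaschke_factor_def norm_divide)
qed

section \<open>The model space and composition with a Blaschke product\<close>

text \<open>
  The hypothesis says that \<open>\<Prod>i. (S\<^sup>* - cnj (a\<^sub>i))\<close> annihilates \<open>v\<close>, where \<open>S\<^sup>*\<close> is the backward shift. Peeling
  off one factor leaves \<open>w = (S\<^sup>* - cnj b) v\<close>, which extends by induction, and solving for \<open>v\<close> gives
  \<open>v = (v 0 + z w) / (1 - cnj b z)\<close>, whose denominator has no zero in the larger disc.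
\<close>

lemma annihilator_extends:
  fixes m :: nat
  assumes "R > 1"
  shows "(\<And>i. i \<in> {1..m} \<Longrightarrow> R * cmod (a i) < 1) \<Longrightarrow> v \<in> A_space 0 \<Longrightarrow>
    (\<And>h. h \<in> A_space 0 \<Longrightarrow> Hardy2_inner v (\<lambda>z. (\<Prod>i=1..m. z - a i) * h z) = 0) \<Longrightarrow>
    \<exists>V. V holomorphic_on ball 0 R \<and> (\<forall>z. cmod z < 1 \<longrightarrow> v z = V z)"
proof (induction m arbitrary: v)
  case 0
  have "v = 0" by (rule Hardy2_inner_self_eq_0) (use 0(3)[OF 0(2)] 0(2) in simp_all)
  then show ?case by (intro exI[of _ "\<lambda>z. 0"]) auto
next
  case (Suc m)
  define b where "b = a (Suc m)"
  define c where "c k = coef v (Suc k) - cnj b * coef v k" for k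
  define w where "w = disc_series c"
  have Rb: "R * cmod b < 1" using Suc.prems(1) by (simp add: b_def)
  have cv: "coef v \<in> weighted_l2 0" using Suc.prems(2) by (simp add: A_space_iff)
  then have "(\<lambda>k. coef v (Suc k)) \<in> weighted_l2 0"
    using summable_Suc_iff[of "\<lambda>k. (cmod (coef v k))\<^sup>2"] by (simp add: weighted_l2_def)
  then have c: "c \<in> weighted_l2 0" unfolding c_def by (intro weighted_l2_diff weighted_l2_cmult cv)
  have w: "w \<in> A_space 0" "coef w = c"
    using c by (simp_all add: w_def disc_series_in_A_space coef_disc_series)
  have adj: "Hardy2_inner w h = Hardy2_inner v (\<lambda>z. (z - b) * h z)" if h: "h \<in> A_space 0" for h
  proof -
    have "(\<lambda>z. (z - b) * h z) = shift h + fscale (- b) h"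
      by (simp add: fun_eq_iff shift_def fscale_def algebra_simps)
    then have "Hardy2_inner v (\<lambda>z. (z - b) * h z)
      = Hardy2_inner v (shift h) + Hardy2_inner v (fscale (- b) h)"
      using Suc.prems(2) h by (simp only: Hardy2_inner_add_right shift_in_A_space A_space_fscale)
    also have "Hardy2_inner v (fscale (- b) h) = - cnj b * Hardy2_inner v h"
      using Hardy2_inner_fscale_right[OF h Suc.prems(2), of "- b"] by simp
    also have "Hardy2_inner v (shift h) + - cnj b * Hardy2_inner v h = Hardy2_inner w h"
    proof -
      have "(\<lambda>k. coef v (Suc k) * cnj (coef (shift h) (Suc k))) sums Hardy2_inner v (shift h)"
      proof (subst sums_Suc_iff, simp add: coef_shift[OF A_space_holo[OF h]])
        have "(\<lambda>k. coef v k * cnj (coef (shift h) k)) sums Hardy2_inner v (shift h)"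
          unfolding Hardy2_inner_def
          by (intro summable_sums Hardy2_inner_summable shift_in_A_space h Suc.prems(2))
        then show "(\<lambda>k. coef v k * cnj (case k of 0 \<Rightarrow> 0 | Suc k \<Rightarrow> coef h k)) sums Hardy2_inner v (shift h)"
          by (simp add: coef_shift[OF A_space_holo[OF h]])
      qed
      then have 1: "(\<lambda>k. coef v (Suc k) * cnj (coef h k)) sums Hardy2_inner v (shift h)"
        by (simp add: coef_shift[OF A_space_holo[OF h]])
      have 2: "(\<lambda>k. - cnj b * (coef v k * cnj (coef h k))) sums (- cnj b * Hardy2_inner v h)"
        unfolding Hardy2_inner_def
        by (intro sums_mult summable_sums Hardy2_inner_summable h Suc.prems(2))
      have "(\<lambda>k. coef w k * cnj (coef h k)) sums (Hardy2_inner v (shift h) + - cnj b * Hardy2_inner v h)"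
        using sums_add[OF 1 2] by (simp add: w c_def algebra_simps)
      then show ?thesis by (simp add: Hardy2_inner_def sums_iff)
    qed
    finally show ?thesis by simp
  qed
  have "\<exists>V. V holomorphic_on ball 0 R \<and> (\<forall>z. cmod z < 1 \<longrightarrow> w z = V z)"
  proof (rule Suc.IH)
    fix h assume h: "h \<in> A_space 0"
    have "(\<lambda>z. \<Prod>i=1..m. z - a i) * h \<in> A_space 0"
      by (rule A_space_mult_holo[OF _ assms h]) (intro holomorphic_intros)
    then have "Hardy2_inner w (\<lambda>z. (\<Prod>i=1..m. z - a i) * h z)
      = Hardy2_inner v (\<lambda>z. (z - b) * ((\<Prod>i=1..m. z - a i) * h z))"
      using adj by (simp add: times_fun_def)
    also have "\<dots> = Hardy2_inner v (\<lambda>z. (\<Prod>i=1..Suc m. z - a i) * h z)"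
      by (simp add: b_def mult_ac)
    also have "\<dots> = 0" by (rule Suc.prems(3)[OF h])
    finally show "Hardy2_inner w (\<lambda>z. (\<Prod>i=1..m. z - a i) * h z) = 0" .
  qed (use Suc.prems w in auto)
  then obtain V where V: "V holomorphic_on ball 0 R" "\<And>z. cmod z < 1 \<Longrightarrow> w z = V z" by auto
  have nz: "1 - cnj b * z \<noteq> 0" if "cmod z < R" for z
    by (rule one_minus_cnj_mult_nonzero[OF Rb that])
  have "v z = (coef v 0 + z * V z) / (1 - cnj b * z)" if z: "cmod z < 1" for z
  proof -
    have vz: "(\<lambda>k. coef v k * z ^ k) sums v z"
      by (rule coef_sums[OF A_space_holo[OF Suc.prems(2)] z])
    have "(\<lambda>k. coef v (Suc k) * z ^ Suc k) sums (v z - coef v 0)"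
      by (subst sums_Suc_iff) (use vz in simp)
    from sums_diff[OF this sums_mult[OF vz, of "cnj b * z"]]
    have "(\<lambda>k. z * (coef w k * z ^ k)) sums (v z - coef v 0 - cnj b * z * v z)"
      by (simp add: w c_def algebra_simps)
    moreover have "(\<lambda>k. z * (coef w k * z ^ k)) sums (z * w z)"
      by (intro sums_mult coef_sums[OF A_space_holo[OF w(1)] z])
    ultimately have "v z - coef v 0 - cnj b * z * v z = z * V z"
      using V(2)[OF z] sums_unique2 by metis
    then have "v z * (1 - cnj b * z) = coef v 0 + z * V z" by (simp add: algebra_simps)
    then show ?thesis using nz[of z] z assms by (simp add: eq_divide_eq)
  qed
  moreover have "(\<lambda>z. (coef v 0 + z * V z) / (1 - cnj b * z)) holomorphic_on ball 0 R"
    by (intro holomorphic_intros V) (use nz in auto)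
  ultimately show ?case by blast
qed

text \<open>
  A finite Blaschke product together with a radius \<open>R > 1\<close> such that no pole \<open>1 / cnj (a\<^sub>i)\<close> lies in the
  disc of radius \<open>R\<close>.
\<close>

locale blaschke =
  fixes n :: nat and B :: "complex \<Rightarrow> complex" and c :: complex and a :: "nat \<Rightarrow> complex" and R :: real
  assumes n: "n \<ge> 1" and c: "cmod c = 1" and R: "R > 1"
    and a: "\<And>i. i \<in> {1..n} \<Longrightarrow> R * cmod (a i) < 1"
    and B: "\<And>z. cmod z < 1 \<Longrightarrow> B z = c * (\<Prod>i=1..n. blaschke_factor (a i) z)"

lemma finite_Blaschke_product_blaschke:
  assumes "n \<ge> 1" "finite_Blaschke_product n B"
  obtains c a R where "blaschke n B c a R"
proof -
  obtain \<theta> :: real and a where a: "\<And>i. i \<in> {1..n} \<Longrightarrow> cmod (a i) < 1"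
    and B: "\<And>z. z \<in> ball 0 1 \<Longrightarrow> B z = exp (\<i> * of_real \<theta>) * (\<Prod>i=1..n. (z - a i) / (1 - cnj (a i) * z))"
    using assms(2) unfolding finite_Blaschke_product_def by (metis mem_ball_0)
  define M where "M = Max (cmod ` a ` {1..n})"
  have M: "M < 1" "\<And>i. i \<in> {1..n} \<Longrightarrow> cmod (a i) \<le> M"
    using assms(1) a by (auto simp: M_def)
  have "0 \<le> M" using assms(1) by (intro order_trans[OF norm_ge_zero M(2)[of 1]]) auto
  define R where "R = 2 / (1 + M)"
  have R: "R > 1" "R * M < 1" using M(1) \<open>0 \<le> M\<close> by (auto simp: R_def field_simps)
  have "R * cmod (a i) < 1" if "i \<in> {1..n}" for i
    using mult_left_mono[OF M(2)[OF that], of R] R by linarith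
  then have "blaschke n B (exp (\<i> * of_real \<theta>)) a R"
    using assms(1) R B by unfold_locales (auto simp: blaschke_factor_def)
  then show thesis by (rule that)
qed

context blaschke
begin

definition B_ext :: "complex \<Rightarrow> complex" where
  "B_ext z = c * (\<Prod>i=1..n. blaschke_factor (a i) z)"

lemma B_ext_holo: "B_ext holomorphic_on ball 0 R"
  unfolding B_ext_def[abs_def] by (intro holomorphic_intros blaschke_factor_holo a)

lemma B_eq_B_ext: "cmod z < 1 \<Longrightarrow> B z = B_ext z"
  using B by (simp add: B_ext_def)

lemma B_mult_eq: "f \<in> disc_analytic \<Longrightarrow> B * f = B_ext * f"
proof
  fix z assume "f \<in> disc_analytic"
  then show "(B * f) z = (B_ext * f) z"
    using B_eq_B_ext[of z] disc_analytic_outside[of f z] by (cases "cmod z < 1") auto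
qed

lemma B_mult_in_A_space:
  assumes "f \<in> A_space \<alpha>"
  shows "B * f \<in> A_space \<alpha>"
proof -
  have "f \<in> disc_analytic" using assms by (simp add: A_space_iff)
  then show ?thesis
    unfolding B_mult_eq[OF \<open>f \<in> disc_analytic\<close>] by (intro A_space_mult_holo[OF B_ext_holo R] assms)
qed

lemma a_disc: "i \<in> {1..n} \<Longrightarrow> cmod (a i) < 1"
  using a[of i] mult_right_mono[of 1 R "cmod (a i)"] R by auto

lemma B_in_disc:
  assumes "cmod z < 1"
  shows "cmod (B z) < 1"
proof -
  have le: "cmod (blaschke_factor (a i) z) < 1" if "i \<in> {1..n}" for i
    by (rule blaschke_factor_norm_less[OF a_disc[OF that] assms])
  have "cmod (B z) = (\<Prod>i\<in>{1..n}. cmod (blaschke_factor (a i) z))"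
    using B[OF assms] c by (simp add: norm_mult prod_norm)
  also have "\<dots> = cmod (blaschke_factor (a 1) z) * (\<Prod>i\<in>{1..n} - {1}. cmod (blaschke_factor (a i) z))"
    by (rule prod.remove) (use n in auto)
  also have "\<dots> \<le> cmod (blaschke_factor (a 1) z) * 1"
    by (intro mult_left_mono prod_le_1) (use le in \<open>auto intro: less_imp_le\<close>)
  also have "\<dots> < 1" using le[of 1] n by simp
  finally show ?thesis .
qed

lemma Hardy2_inner_B:
  assumes f: "f \<in> A_space 0" "g \<in> A_space 0"
  shows "Hardy2_inner (B * f) (B * g) = Hardy2_inner f g"
proof -
  have *: "(\<lambda>z. \<Prod>i=1..m. blaschke_factor (a i) z) * f \<in> A_space 0" if "m \<le> n" "f \<in> A_space 0" for m f
    by (rule A_space_mult_holo[OF _ R that(2)]) (intro holomorphic_intros blaschke_factor_holo a, use that in auto)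
  have "m \<le> n \<Longrightarrow> Hardy2_inner ((\<lambda>z. \<Prod>i=1..m. blaschke_factor (a i) z) * f) ((\<lambda>z. \<Prod>i=1..m. blaschke_factor (a i) z) * g)
    = Hardy2_inner f g" for m
  proof (induction m)
    case 0
    then show ?case by (simp add: times_fun_def)
  next
    case (Suc m)
    have e: "(\<lambda>z. \<Prod>i=1..Suc m. blaschke_factor (a i) z) * h = blaschke_factor (a (Suc m)) * ((\<lambda>z. \<Prod>i=1..m. blaschke_factor (a i) z) * h)" for h
      by (simp add: fun_eq_iff mult_ac)
    have "R * cmod (a (Suc m)) < 1" using a Suc.prems by auto
    then have "Hardy2_inner (blaschke_factor (a (Suc m)) * ((\<lambda>z. \<Prod>i=1..m. blaschke_factor (a i) z) * f))
        (blaschke_factor (a (Suc m)) * ((\<lambda>z. \<Prod>i=1..m. blaschke_factor (a i) z) * g))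
      = Hardy2_inner ((\<lambda>z. \<Prod>i=1..m. blaschke_factor (a i) z) * f) ((\<lambda>z. \<Prod>i=1..m. blaschke_factor (a i) z) * g)"
      using Suc.prems by (intro Hardy2_inner_blaschke_factor[OF R] * f) auto
    also have "\<dots> = Hardy2_inner f g" by (rule Suc.IH) (use Suc.prems in simp)
    finally show ?case unfolding e .
  qed
  then have main: "Hardy2_inner ((\<lambda>z. \<Prod>i=1..n. blaschke_factor (a i) z) * f) ((\<lambda>z. \<Prod>i=1..n. blaschke_factor (a i) z) * g) = Hardy2_inner f g"
    by simp
  have e: "B * h = fscale c ((\<lambda>z. \<Prod>i=1..n. blaschke_factor (a i) z) * h)" if "h \<in> A_space 0" for h
  proof -
    have "h \<in> disc_analytic" using that by (simp add: A_space_iff)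
    then show ?thesis
      by (subst B_mult_eq) (simp_all add: fun_eq_iff fscale_def B_ext_def mult.assoc)
  qed
  have cc: "c * cnj c = 1" using c by (simp add: complex_norm_square[symmetric])
  let ?P = "\<lambda>z. \<Prod>i=1..n. blaschke_factor (a i) z"
  have P: "?P * f \<in> A_space 0" "?P * g \<in> A_space 0" by (rule *[OF order_refl f(1)], rule *[OF order_refl f(2)])
  have "Hardy2_inner (B * f) (B * g) = (c * cnj c) * Hardy2_inner (?P * f) (?P * g)"
    unfolding e[OF f(1)] e[OF f(2)] Hardy2_inner_fscale_left[OF P(1) A_space_fscale[OF P(2)]]
      Hardy2_inner_fscale_right[OF P(2,1)] by (simp only: mult.assoc)
  then show ?thesis unfolding cc main by simp
qed

lemma model_space_A_space: "v \<in> model_space B \<Longrightarrow> v \<in> A_space 0"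
  by (simp add: model_space_def Hardy2_def)

lemma model_space_orth: "v \<in> model_space B \<Longrightarrow> g \<in> A_space 0 \<Longrightarrow> Hardy2_inner v (B * g) = 0"
  by (simp add: model_space_def Hardy2_def)

text \<open>
  Writing \<open>B = c P / Q\<close> with \<open>P = \<Prod>i. (z - a\<^sub>i)\<close> and \<open>Q = \<Prod>i. (1 - cnj (a\<^sub>i) z)\<close>, a function orthogonal to
  all \<open>B g\<close> is orthogonal to all \<open>P h\<close>: take \<open>g = Q h\<close>.
\<close>

lemma model_space_extends:
  assumes v: "v \<in> model_space B"
  obtains V where "V holomorphic_on ball 0 R" "\<And>z. cmod z < 1 \<Longrightarrow> v z = V z"
proof -
  have "Hardy2_inner v (\<lambda>z. (\<Prod>i=1..n. z - a i) * h z) = 0" if h: "h \<in> A_space 0" for h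
  proof -
    define Q where "Q z = (\<Prod>i=1..n. 1 - cnj (a i) * z)" for z
    have Qh: "Q * h \<in> A_space 0"
      by (rule A_space_mult_holo[OF _ R h]) (unfold Q_def[abs_def], intro holomorphic_intros)
    have Ph: "(\<lambda>z. \<Prod>i=1..n. z - a i) * h \<in> A_space 0"
      by (rule A_space_mult_holo[OF _ R h]) (intro holomorphic_intros)
    have "B * (Q * h) = fscale c ((\<lambda>z. \<Prod>i=1..n. z - a i) * h)"
    proof (rule disc_analytic_eqI)
      fix z :: complex assume z: "cmod z < 1"
      have nz: "1 - cnj (a i) * z \<noteq> 0" if "i \<in> {1..n}" for i
        by (rule one_minus_cnj_mult_nonzero[OF a[OF that]]) (use z R in linarith)
      have "(\<Prod>i=1..n. blaschke_factor (a i) z) * Q z = (\<Prod>i=1..n. z - a i)"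
        unfolding Q_def prod.distrib[symmetric] by (rule prod.cong) (use nz in \<open>auto simp: blaschke_factor_def\<close>)
      then show "(B * (Q * h)) z = fscale c ((\<lambda>z. \<Prod>i=1..n. z - a i) * h) z"
        using B[OF z] by (simp add: fscale_def mult.assoc[symmetric])
    qed (use B_mult_in_A_space[OF Qh] A_space_fscale[OF Ph] in \<open>auto simp: A_space_iff\<close>)
    then have "Hardy2_inner v (fscale c ((\<lambda>z. \<Prod>i=1..n. z - a i) * h)) = 0"
      using model_space_orth[OF v Qh] by simp
    then have "cnj c * Hardy2_inner v ((\<lambda>z. \<Prod>i=1..n. z - a i) * h) = 0"
      unfolding Hardy2_inner_fscale_right[OF Ph model_space_A_space[OF v]] .
    then show ?thesis using c by (auto simp: times_fun_def)
  qed
  then have "\<exists>V. V holomorphic_on ball 0 R \<and> (\<forall>z. cmod z < 1 \<longrightarrow> v z = V z)"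
    by (intro annihilator_extends[OF R, where m = n and a = a] a model_space_A_space[OF v]) auto
  then show thesis using that by blast
qed

lemma model_space_mult:
  assumes v: "v \<in> model_space B" and f: "f \<in> A_space \<alpha>"
  shows "v * f \<in> A_space \<alpha>"
proof -
  obtain V where V: "V holomorphic_on ball 0 R" "\<And>z. cmod z < 1 \<Longrightarrow> v z = V z"
    using model_space_extends[OF v] by blast
  have "v * f = V * f"
  proof
    fix z show "(v * f) z = (V * f) z"
      using V(2)[of z] disc_analytic_outside[of f z] f
      by (cases "cmod z < 1") (auto simp: A_space_iff)
  qed
  then show ?thesis using A_space_mult_holo[OF V(1) R f] by simp
qed

text \<open>
  \<open>v\<close> is its own product with the constant function one, which lies in every \<open>A_space\<close>.
\<close>

lemma model_space_subset_A_space: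
  assumes v: "v \<in> model_space B"
  shows "v \<in> A_space \<alpha>"
proof -
  define e where "e = disc_series (\<lambda>k. if k = 0 then 1 else 0)"
  have "(\<lambda>k. if k = 0 then 1 else 0) \<in> weighted_l2 \<alpha>"
    using trunc_in_weighted_l2[of 1 "\<lambda>k. 1" \<alpha>] by (simp add: trunc_def)
  then have e: "e \<in> A_space \<alpha>" unfolding e_def by (rule disc_series_in_A_space)
  have e1: "e z = 1" if "cmod z < 1" for z
    using sums_If_finite_set[of "{0::nat}" "\<lambda>k. z ^ k"] that
    by (simp add: e_def disc_series_def sums_iff if_distrib[where f = "\<lambda>x. x * _"] cong: if_cong)
  have "v * e = v"
  proof
    fix z show "(v * e) z = v z"
      using e1[of z] disc_analytic_outside[of v z] model_space_A_space[OF v]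
      by (cases "cmod z < 1") (auto simp: A_space_iff)
  qed
  then show ?thesis using model_space_mult[OF v e] by simp
qed

text \<open>
  The map \<open>f \<mapsto> v (f \<circ> B)\<close> sends \<open>z^m\<close> to \<open>v B^m\<close>; these functions are the columns of its matrix and
  span the images of polynomials.
\<close>

definition twisted_pow :: "(complex \<Rightarrow> complex) \<Rightarrow> nat \<Rightarrow> complex \<Rightarrow> complex" where
  "twisted_pow v m = (\<lambda>z. v z * B z ^ m)"

definition comp_matrix :: "(complex \<Rightarrow> complex) \<Rightarrow> nat \<Rightarrow> nat \<Rightarrow> complex" where
  "comp_matrix v k m = coef (twisted_pow v m) k"

definition twisted_poly :: "(complex \<Rightarrow> complex) \<Rightarrow> nat \<Rightarrow> (nat \<Rightarrow> complex) \<Rightarrow> complex \<Rightarrow> complex" where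
  "twisted_poly v M x = (\<Sum>m<M. fscale (x m) (twisted_pow v m))"

lemma twisted_pow_0: "twisted_pow v 0 = v"
  by (simp add: twisted_pow_def)

lemma twisted_pow_Suc: "twisted_pow v (Suc m) = B * twisted_pow v m"
  by (simp add: twisted_pow_def fun_eq_iff)

lemma twisted_pow_in_A_space: "v \<in> A_space \<alpha> \<Longrightarrow> twisted_pow v m \<in> A_space \<alpha>"
  by (induction m) (simp_all add: twisted_pow_0 twisted_pow_Suc B_mult_in_A_space)

lemma twisted_poly_in_A_space: "v \<in> A_space \<alpha> \<Longrightarrow> twisted_poly v M x \<in> A_space \<alpha>"
  unfolding twisted_poly_def by (intro A_space_sum A_space_fscale twisted_pow_in_A_space)

lemma twisted_poly_Suc: "twisted_poly v (Suc M) x = twisted_poly v M x + fscale (x M) (twisted_pow v M)"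
  by (simp add: twisted_poly_def)

lemma twisted_poly_apply: "twisted_poly v M x z = (\<Sum>m<M. x m * (v z * B z ^ m))"
  by (induction M) (simp_all add: twisted_poly_Suc fscale_def twisted_pow_def, simp add: twisted_poly_def)

lemma twisted_poly_Suc_shift: "twisted_poly v (Suc M) x = fscale (x 0) v + B * twisted_poly v M (\<lambda>m. x (Suc m))"
  by (simp add: fun_eq_iff twisted_poly_apply sum.lessThan_Suc_shift fscale_def sum_distrib_left mult_ac
      del: sum.lessThan_Suc)

lemma coef_twisted_poly:
  assumes v: "v \<in> A_space \<alpha>"
  shows "coef (twisted_poly v M x) k = (\<Sum>m<M. comp_matrix v k m * x m)"
proof (induction M)
  case 0
  have "coef (twisted_poly v 0 x) = (\<lambda>k. 0)" by (rule coef_eqI) (simp add: twisted_poly_def)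
  then show ?case by simp
next
  case (Suc M)
  have "coef (twisted_poly v (Suc M) x) k = coef (twisted_poly v M x) k + coef (fscale (x M) (twisted_pow v M)) k"
    unfolding twisted_poly_Suc
    by (intro coef_add A_space_holo[where \<alpha> = \<alpha>] twisted_poly_in_A_space[OF v] A_space_fscale twisted_pow_in_A_space[OF v])
  also have "coef (fscale (x M) (twisted_pow v M)) k = x M * comp_matrix v k M"
    unfolding comp_matrix_def by (intro coef_fscale A_space_holo[where \<alpha> = \<alpha>] twisted_pow_in_A_space[OF v])
  finally show ?case using Suc by simp
qed

text \<open>
  By \<open>twisted_poly_Suc_shift\<close> the polynomial is a multiple of \<open>v\<close> plus \<open>B\<close> times a polynomial of the
  same kind. The two parts are orthogonal and \<open>B\<close> acts isometrically, so induction applies.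
\<close>

lemma Hardy2_inner_twisted_poly:
  assumes v: "v \<in> model_space B"
  shows "Hardy2_inner (twisted_poly v M x) (twisted_poly v M x) = of_real (\<Sum>m<M. (cmod (x m))\<^sup>2) * Hardy2_inner v v"
proof (induction M arbitrary: x)
  case 0
  have "coef (twisted_poly v 0 x) = (\<lambda>k. 0)" by (rule coef_eqI) (simp add: twisted_poly_def)
  then show ?case by (simp add: Hardy2_inner_def)
next
  case (Suc M)
  let ?h = "twisted_poly v M (\<lambda>m. x (Suc m))"
  have v0: "v \<in> A_space 0" by (rule model_space_A_space[OF v])
  have h: "?h \<in> A_space 0" "B * ?h \<in> A_space 0" by (intro B_mult_in_A_space twisted_poly_in_A_space[OF v0])+
  have o: "Hardy2_inner v (B * ?h) = 0" by (rule model_space_orth[OF v h(1)])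
  have o': "Hardy2_inner (B * ?h) v = 0" using Hardy2_inner_cnj[OF v0 h(2)] o by simp
  have "Hardy2_inner (twisted_poly v (Suc M) x) (twisted_poly v (Suc M) x)
    = x 0 * cnj (x 0) * Hardy2_inner v v + Hardy2_inner ?h ?h"
    unfolding twisted_poly_Suc_shift
    by (simp add: Hardy2_inner_linear A_space_add A_space_fscale v0 h o o' Hardy2_inner_B)
  also have "\<dots> = (of_real ((cmod (x 0))\<^sup>2) + of_real (\<Sum>m<M. (cmod (x (Suc m)))\<^sup>2)) * Hardy2_inner v v"
    unfolding Suc.IH complex_norm_square by (simp add: algebra_simps)
  also have "\<dots> = of_real (\<Sum>m<Suc M. (cmod (x m))\<^sup>2) * Hardy2_inner v v"
    by (simp add: sum.lessThan_Suc_shift del: sum.lessThan_Suc)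
  finally show ?case .
qed

lemma comp_matrix_section_bounded_0:
  assumes v: "v \<in> model_space B"
  shows "section_bounded 0 (comp_matrix v) (sqnorm 0 (coef v))"
  unfolding section_bounded_def
proof (intro conjI allI)
  have v0: "v \<in> A_space 0" by (rule model_space_A_space[OF v])
  show "0 \<le> sqnorm 0 (coef v)" using v0 by (intro sqnorm_nonneg) (simp add: A_space_iff)
  fix K M :: nat and x :: "nat \<Rightarrow> complex"
  have g: "twisted_poly v M x \<in> A_space 0" by (rule twisted_poly_in_A_space[OF v0])
  have "complex_of_real (sqnorm 0 (coef (twisted_poly v M x))) = of_real ((\<Sum>m<M. (cmod (x m))\<^sup>2) * sqnorm 0 (coef v))"
    using Hardy2_inner_twisted_poly[OF v, of M x] unfolding Hardy2_inner_self[OF g] Hardy2_inner_self[OF v0]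
    by simp
  then have e: "sqnorm 0 (coef (twisted_poly v M x)) = (\<Sum>m<M. (cmod (x m))\<^sup>2) * sqnorm 0 (coef v)"
    by (simp only: of_real_eq_iff)
  have "(\<Sum>k<K. (cmod (\<Sum>m<M. comp_matrix v k m * x m))\<^sup>2 * weight 0 k) = (\<Sum>k<K. (cmod (coef (twisted_poly v M x) k))\<^sup>2 * weight 0 k)"
    by (simp add: coef_twisted_poly[OF v0])
  also have "\<dots> \<le> sqnorm 0 (coef (twisted_poly v M x))"
    using g by (intro sum_le_sqnorm) (auto simp: A_space_iff)
  finally show "(\<Sum>k<K. (cmod (\<Sum>m<M. comp_matrix v k m * x m))\<^sup>2 * weight 0 k) \<le> sqnorm 0 (coef v) * (\<Sum>m<M. (cmod (x m))\<^sup>2 * weight 0 m)"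
    unfolding e by (simp add: mult.commute)
qed

lemma continuous_bounded_on_cball:
  assumes "continuous_on (cball 0 r) (f :: complex \<Rightarrow> complex)" "0 \<le> r"
  obtains z0 where "cmod z0 \<le> r" "\<And>z. cmod z \<le> r \<Longrightarrow> cmod (f z) \<le> cmod (f z0)"
proof -
  have "continuous_on (cball 0 r) (\<lambda>z. cmod (f z))" by (intro continuous_intros assms)
  from continuous_attains_sup[OF _ _ this] assms(2) show thesis
    by (auto intro: that)
qed

text \<open>
  Cauchy's estimate for \<open>v B^m\<close> on \<open>\<bar>z\<bar> = r\<close> with \<open>1 < r < R\<close>, where \<open>B\<close> is bounded, and on
  \<open>\<bar>z\<bar> = 1/2\<close>, where \<open>\<bar>B\<bar>\<close> has a maximum below one.
\<close>

lemma comp_matrix_off_diagonal_decay: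
  assumes v: "v \<in> model_space B"
  shows "off_diagonal_decay (comp_matrix v)"
proof -
  obtain V where V: "V holomorphic_on ball 0 R" "\<And>z. cmod z < 1 \<Longrightarrow> v z = V z"
    using model_space_extends[OF v] by blast
  define r where "r = (1 + R) / 2"
  have r: "1 < r" "r < R" using R by (auto simp: r_def)
  have sub: "cball 0 r \<subseteq> ball (0::complex) R" "cball 0 (1/2) \<subseteq> ball (0::complex) R" using r by auto
  have cont: "continuous_on (cball 0 r) V" "continuous_on (cball 0 r) B_ext" "continuous_on (cball 0 (1/2)) B_ext"
    using V(1) B_ext_holo sub holomorphic_on_imp_continuous_on holomorphic_on_subset by blast+
  obtain z1 where z1: "cmod z1 \<le> r" "\<And>z. cmod z \<le> r \<Longrightarrow> cmod (V z) \<le> cmod (V z1)"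
    by (rule continuous_bounded_on_cball[OF cont(1)]) (use r in simp, rule that)
  obtain z2 where z2: "cmod z2 \<le> r" "\<And>z. cmod z \<le> r \<Longrightarrow> cmod (B_ext z) \<le> cmod (B_ext z2)"
    by (rule continuous_bounded_on_cball[OF cont(2)]) (use r in simp, rule that)
  obtain z3 where z3: "cmod z3 \<le> 1/2" "\<And>z. cmod z \<le> 1/2 \<Longrightarrow> cmod (B_ext z) \<le> cmod (B_ext z3)"
    by (rule continuous_bounded_on_cball[OF cont(3)]) (simp, rule that)
  define C where "C = cmod (V z1)"
  define M where "M = max 2 (cmod (B_ext z2))"
  define s where "s = max (1 / r) (cmod (B_ext z3))"
  have s: "0 < s" "s < 1"
    using r z3(1) B_in_disc[of z3] B_eq_B_ext[of z3] by (auto simp: s_def less_max_iff_disj)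
  define g where "g m z = V z * B_ext z ^ m" for m z
  have g: "g m holomorphic_on ball 0 R" for m
    unfolding g_def[abs_def] by (intro holomorphic_intros V B_ext_holo)
  have comp_matrix: "comp_matrix v k m = coef (g m) k" for k m
  proof -
    have "g m holomorphic_on ball 0 1" by (rule holomorphic_on_subset[OF g]) (use R in auto)
    then have "coef (twisted_pow v m) = coef (g m)"
      by (rule coef_cong) (auto simp: g_def twisted_pow_def V(2) B_eq_B_ext)
    then show ?thesis by (simp add: comp_matrix_def)
  qed
  have 1: "cmod (comp_matrix v k m) \<le> C * M ^ m * s ^ k" for k m
  proof -
    have "cmod (g m z) \<le> C * M ^ m" if "cmod z = r" for z
      using z1(2)[of z] z2(2)[of z] that
      by (auto simp: g_def norm_mult norm_power C_def M_def intro!: mult_mono power_mono)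
    then have "cmod (coef (g m) k) \<le> C * M ^ m / r ^ k"
      using r by (intro coef_bound[OF g]) auto
    then have "cmod (comp_matrix v k m) \<le> C * M ^ m * (1 / r) ^ k" by (simp add: comp_matrix power_divide)
    also have "\<dots> \<le> C * M ^ m * s ^ k"
      using r by (intro mult_left_mono power_mono) (auto simp: s_def C_def M_def)
    finally show ?thesis .
  qed
  have 2: "cmod (comp_matrix v k m) \<le> C * M ^ k * s ^ m" for k m
  proof -
    have "cmod (g m z) \<le> C * s ^ m" if "cmod z = 1/2" for z
      using z1(2)[of z] z3(2)[of z] that r
      by (auto simp: g_def norm_mult norm_power C_def s_def intro!: mult_mono power_mono)
    then have "cmod (coef (g m) k) \<le> C * s ^ m / (1/2) ^ k"
      using R by (intro coef_bound[OF g]) auto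
    then have "cmod (comp_matrix v k m) \<le> C * s ^ m * 2 ^ k" by (simp add: comp_matrix power_divide)
    also have "\<dots> \<le> C * s ^ m * M ^ k"
      using s by (intro mult_left_mono power_mono) (auto simp: M_def C_def)
    finally show ?thesis by (simp add: mult_ac)
  qed
  show ?thesis
    unfolding off_diagonal_decay_def
    by (rule exI[of _ C], rule exI[of _ M], rule exI[of _ s]) (use 1 2 s in \<open>auto simp: C_def M_def\<close>)
qed

lemma comp_matrix_section_bounded:
  assumes "v \<in> model_space B"
  obtains C where "section_bounded \<alpha> (comp_matrix v) C"
  using off_diagonal_decay_section_bounded[OF comp_matrix_section_bounded_0[OF assms] comp_matrix_off_diagonal_decay[OF assms]] by metis

lemma comp_matrix_adjoint_matrix_section_bounded:
  assumes "v \<in> model_space B"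
  obtains C where "section_bounded \<alpha> (adjoint_matrix (comp_matrix v)) C"
  using off_diagonal_decay_section_bounded[OF section_bounded_adjoint_matrix[OF comp_matrix_section_bounded_0[OF assms]]
    off_diagonal_decay_adjoint_matrix[OF comp_matrix_off_diagonal_decay[OF assms]]] by metis

text \<open>
  Boundedness of composition operators in matrix form: both sides agree for the Taylor polynomials of
  \<open>f\<close>, and both converge pointwise.
\<close>

lemma comp_in_A_space:
  assumes v: "v \<in> model_space B" and f: "f \<in> A_space \<alpha>"
  shows "v * (f \<circ> B) \<in> A_space \<alpha>" "coef (v * (f \<circ> B)) = mat_app (comp_matrix v) (coef f)"
proof -
  obtain C where C: "section_bounded \<alpha> (comp_matrix v) C" using comp_matrix_section_bounded[OF v] .
  have cf: "coef f \<in> weighted_l2 \<alpha>" using f by (simp add: A_space_iff)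
  have va: "v \<in> A_space \<alpha>" by (rule model_space_subset_A_space[OF v])
  have m: "mat_app (comp_matrix v) (coef f) \<in> weighted_l2 \<alpha>" by (rule mat_app_bounded[OF C cf])
  have "(v * (f \<circ> B)) z = (\<Sum>k. mat_app (comp_matrix v) (coef f) k * z ^ k)" if z: "cmod z < 1" for z
  proof (rule LIMSEQ_unique)
    have Bz: "cmod (B z) < 1" by (rule B_in_disc[OF z])
    have "(\<lambda>m. v z * (coef f m * B z ^ m)) sums (v z * f (B z))"
      by (intro sums_mult coef_sums A_space_holo[OF f] Bz)
    then have "(\<lambda>N. twisted_poly v N (coef f) z) \<longlonglongrightarrow> v z * f (B z)"
      by (simp add: sums_def twisted_poly_apply mult_ac)
    moreover have "twisted_poly v N (coef f) z = (\<Sum>k. mat_app (comp_matrix v) (trunc N (coef f)) k * z ^ k)" for N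
      using A_space_series[OF twisted_poly_in_A_space[OF va] z]
      by (simp add: mat_app_trunc coef_twisted_poly[OF va])
    ultimately show "(\<lambda>N. \<Sum>k. mat_app (comp_matrix v) (trunc N (coef f)) k * z ^ k) \<longlonglongrightarrow> (v * (f \<circ> B)) z"
      by simp
    show "(\<lambda>N. \<Sum>k. mat_app (comp_matrix v) (trunc N (coef f)) k * z ^ k) \<longlonglongrightarrow> (\<Sum>k. mat_app (comp_matrix v) (coef f) k * z ^ k)"
      by (rule power_series_tendsto[OF m _ mat_app_trunc_tendsto[OF C cf] z]) (rule mat_app_bounded[OF C], simp)
  qed
  moreover have "(v * (f \<circ> B)) z = 0" if "1 \<le> cmod z" for z
    using disc_analytic_outside[of v z] va that by (simp add: A_space_iff)
  ultimately show "v * (f \<circ> B) \<in> A_space \<alpha>" "coef (v * (f \<circ> B)) = mat_app (comp_matrix v) (coef f)"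
    using A_spaceI[OF m] by blast+
qed

end

section \<open>Dual bases in finite-dimensional subspaces of the Hardy space\<close>

lemma cfun_span_A_space:
  assumes "T \<subseteq> A_space \<alpha>" "p \<in> cfun.span T"
  shows "p \<in> A_space \<alpha>"
  using assms(2)
proof (induction rule: cfun.span_induct_alt)
  case base
  then show ?case by (rule A_space_0)
next
  case (step c x y)
  then show ?case using assms(1) by (intro A_space_add A_space_fscale) auto
qed

lemma Hardy2_inner_zero_right: "Hardy2_inner x 0 = 0"
proof -
  have "coef (0::complex \<Rightarrow> complex) = (\<lambda>k. 0)" by (rule coef_eqI) simp
  then show ?thesis by (simp add: Hardy2_inner_def)
qed

lemma Hardy2_inner_span_eq_0:
  assumes "T \<subseteq> A_space 0" "x \<in> A_space 0" "\<And>y. y \<in> T \<Longrightarrow> Hardy2_inner x y = 0" "p \<in> cfun.span T"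
  shows "Hardy2_inner x p = 0"
proof -
  have "p \<in> A_space 0 \<and> Hardy2_inner x p = 0"
    using assms(4)
  proof (induction rule: cfun.span_induct_alt)
    case base
    then show ?case by (intro conjI A_space_0 Hardy2_inner_zero_right)
  next
    case (step c y z)
    then have "y \<in> A_space 0" using assms(1) by auto
    then have y: "fscale c y \<in> A_space 0" "Hardy2_inner x (fscale c y) = 0"
      using step assms(2,3) by (simp_all add: A_space_fscale Hardy2_inner_fscale_right)
    have "Hardy2_inner x (fscale c y + z) = Hardy2_inner x (fscale c y) + Hardy2_inner x z"
      using y step assms(2) by (intro Hardy2_inner_add_right) auto
    then show ?case using y step A_space_add[of "fscale c y" 0 z] by (simp only: add_0_left simp_thms)
  qed
  then show ?thesis by simp
qed

text \<open>
  Gram-Schmidt, one vector at a time: the component \<open>s\<close> of the new vector \<open>y\<close> orthogonal to the old span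
  either vanishes or supplies one more orthogonal direction.
\<close>

lemma orthogonal_projection_exists:
  assumes "finite T" "T \<subseteq> A_space 0" "x \<in> A_space 0"
  shows "\<exists>p\<in>cfun.span T. \<forall>y\<in>T. Hardy2_inner (x - p) y = 0"
  using assms
proof (induction T arbitrary: x rule: finite_induct)
  case empty
  then show ?case by auto
next
  case (insert y T)
  have T: "T \<subseteq> A_space 0" "y \<in> A_space 0" "x \<in> A_space 0" using insert.prems by auto
  obtain q where q: "q \<in> cfun.span T" "\<forall>t\<in>T. Hardy2_inner (y - q) t = 0"
    using insert.IH[OF T(1,2)] by blast
  obtain p where p: "p \<in> cfun.span T" "\<forall>t\<in>T. Hardy2_inner (x - p) t = 0"
    using insert.IH[OF T(1,3)] by blast
  have A: "q \<in> A_space 0" "p \<in> A_space 0" using q p cfun_span_A_space T(1) by auto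
  define r where "r = x - p"
  define s where "s = y - q"
  have rs: "r \<in> A_space 0" "s \<in> A_space 0" unfolding r_def s_def by (intro A_space_diff T A)+
  have y: "y = s + q" by (simp add: s_def)
  have ins: "cfun.span T \<subseteq> cfun.span (insert y T)" by (rule cfun.span_mono) auto
  show ?case
  proof (cases "s = 0")
    case True
    have "Hardy2_inner (x - p) y = 0"
      using Hardy2_inner_span_eq_0[OF T(1) rs(1), of q] p(2) q(1) True by (simp add: y r_def)
    then have "\<forall>t\<in>insert y T. Hardy2_inner (x - p) t = 0" using p(2) by blast
    then show ?thesis using p(1) ins by blast
  next
    case False
    then have ss: "Hardy2_inner s s \<noteq> 0" using Hardy2_inner_self_eq_0[OF rs(2)] by auto
    define d where "d = Hardy2_inner r s / Hardy2_inner s s"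
    define w where "w = r + fscale (- d) s"
    have w: "w \<in> A_space 0" unfolding w_def by (intro A_space_add A_space_fscale rs)
    have wT: "Hardy2_inner w t = 0" if "t \<in> T" for t
    proof -
      have "t \<in> A_space 0" using that T(1) by auto
      then show ?thesis
        unfolding w_def using rs that p(2) q(2)
        by (simp only: Hardy2_inner_add_left Hardy2_inner_fscale_left A_space_fscale) (simp add: r_def s_def)
    qed
    have "Hardy2_inner w s = Hardy2_inner r s + (- d) * Hardy2_inner s s"
      unfolding w_def using rs by (simp only: Hardy2_inner_add_left Hardy2_inner_fscale_left A_space_fscale)
    then have "Hardy2_inner w s = 0" using ss by (simp add: d_def)
    moreover have "Hardy2_inner w q = 0"
      by (rule Hardy2_inner_span_eq_0[OF T(1) w wT q(1)])
    ultimately have wy: "Hardy2_inner w y = 0"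
      unfolding y using rs A w by (simp only: Hardy2_inner_add_right add_0_left)
    have "p + fscale d s \<in> cfun.span (insert y T)"
      unfolding s_def using p(1) q(1) ins
      by (intro cfun.span_add cfun.span_scale cfun.span_diff) (auto intro: cfun.span_base)
    moreover have "x - (p + fscale d s) = w"
      by (simp add: w_def r_def fun_eq_iff fscale_def)
    moreover have "\<forall>t\<in>insert y T. Hardy2_inner w t = 0" using wT wy by blast
    ultimately show ?thesis by blast
  qed
qed

text \<open>
  The component of \<open>x\<close> orthogonal to the other vectors, normalised; it is nonzero by independence.
\<close>

lemma dual_vector_exists:
  assumes "finite S" "S \<subseteq> A_space 0" "cfun.independent S" "x \<in> S"
  shows "\<exists>v\<in>cfun.span S. Hardy2_inner x v = 1 \<and> (\<forall>y\<in>S - {x}. Hardy2_inner y v = 0)"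
proof -
  have x: "x \<in> A_space 0" and S': "S - {x} \<subseteq> A_space 0" using assms by auto
  obtain p where p: "p \<in> cfun.span (S - {x})" "\<forall>y\<in>S - {x}. Hardy2_inner (x - p) y = 0"
    using orthogonal_projection_exists[of "S - {x}" x] assms(1) S' x by auto
  have pA: "p \<in> A_space 0" by (rule cfun_span_A_space[OF S' p(1)])
  define r where "r = x - p"
  have r: "r \<in> A_space 0" unfolding r_def by (intro A_space_diff x pA)
  have "x \<notin> cfun.span (S - {x})" using assms(3,4) by (auto simp: cfun.dependent_def)
  then have "r \<noteq> 0" using p(1) by (auto simp: r_def)
  then have rr: "Hardy2_inner r r \<noteq> 0" using Hardy2_inner_self_eq_0[OF r] by auto
  have "Hardy2_inner r p = 0"
    by (rule Hardy2_inner_span_eq_0[OF S' r _ p(1)]) (use p(2) in \<open>auto simp: r_def\<close>)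
  then have pr: "Hardy2_inner p r = 0" using Hardy2_inner_cnj[OF r pA] by simp
  have "Hardy2_inner x r = Hardy2_inner (r + p) r" by (simp add: r_def)
  also have "\<dots> = Hardy2_inner r r" using pr by (simp add: Hardy2_inner_add_left r pA)
  finally have xr: "Hardy2_inner x r = Hardy2_inner r r" .
  define v where "v = fscale (1 / Hardy2_inner r r) r"
  have real: "cnj (Hardy2_inner r r) = Hardy2_inner r r" using Hardy2_inner_cnj[OF r r] by simp
  have "v \<in> cfun.span S"
    unfolding v_def r_def
    using p(1) cfun.span_mono[of "S - {x}" S] assms(4)
    by (intro cfun.span_scale cfun.span_diff) (auto intro: cfun.span_base)
  moreover have "Hardy2_inner x v = 1"
    unfolding v_def using rr by (simp add: Hardy2_inner_fscale_right r x xr real)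
  moreover have "Hardy2_inner y v = 0" if "y \<in> S - {x}" for y
  proof -
    have y: "y \<in> A_space 0" using that S' by auto
    have "Hardy2_inner r y = 0" using p(2) that by (simp add: r_def)
    then show ?thesis
      unfolding v_def using Hardy2_inner_cnj[OF r y] by (simp add: Hardy2_inner_fscale_right r y)
  qed
  ultimately show ?thesis by blast
qed

section \<open>The reproducing kernel and the decomposition\<close>

text \<open>
  The Szego kernel, the reproducing kernel of the Hardy space.
\<close>

definition szego :: "complex \<Rightarrow> complex \<Rightarrow> complex" where
  "szego w = disc_series (\<lambda>k. cnj w ^ k)"

lemma szego_in_A_space:
  assumes "cmod w < 1"
  shows "szego w \<in> A_space \<alpha>" "coef (szego w) = (\<lambda>k. cnj w ^ k)"
proof -
  have l: "(\<lambda>k. cnj w ^ k) \<in> weighted_l2 \<alpha>" for \<alpha>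
    using summable_weight_power[of "(cmod w)\<^sup>2" \<alpha>] assms
    by (simp add: weighted_l2_def norm_power power_mult[symmetric] mult.commute abs_square_less_1)
  show "szego w \<in> A_space \<alpha>" "coef (szego w) = (\<lambda>k. cnj w ^ k)"
    unfolding szego_def by (rule disc_series_in_A_space[OF l], rule coef_disc_series[OF l])
qed

lemma szego_apply:
  assumes "cmod w < 1" "cmod z < 1"
  shows "szego w z = 1 / (1 - cnj w * z)"
proof -
  have "cmod w * cmod z < 1"
    using assms by (meson mult_left_le_one_le norm_ge_zero less_imp_le order_le_less_trans)
  then have "cmod (cnj w * z) < 1" by (simp add: norm_mult)
  then have "(\<lambda>k. (cnj w * z) ^ k) sums (1 / (1 - cnj w * z))" by (rule geometric_sums)
  then show ?thesis using assms by (simp add: szego_def disc_series_def power_mult_distrib sums_iff)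
qed

lemma Hardy2_inner_szego:
  assumes "f \<in> A_space 0" "cmod w < 1"
  shows "Hardy2_inner f (szego w) = f w"
  using A_space_series[OF assms] by (simp add: Hardy2_inner_def szego_in_A_space(2)[OF assms(2)])

context blaschke
begin

text \<open>
  The projection of the Szego kernel to the model space, hence its reproducing kernel.
\<close>

definition model_kernel :: "complex \<Rightarrow> complex \<Rightarrow> complex" where
  "model_kernel w = szego w + fscale (- cnj (B w)) (B * szego w)"

lemma model_kernel_in_model_space:
  assumes w: "cmod w < 1"
  shows "model_kernel w \<in> model_space B"
proof -
  have s: "szego w \<in> A_space 0" "B * szego w \<in> A_space 0"
    by (intro B_mult_in_A_space szego_in_A_space w)+
  have k: "model_kernel w \<in> A_space 0" unfolding model_kernel_def by (intro A_space_add A_space_fscale s)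
  have "Hardy2_inner (model_kernel w) (B * g) = 0" if g: "g \<in> A_space 0" for g
  proof -
    have Bg: "B * g \<in> A_space 0" by (rule B_mult_in_A_space[OF g])
    have "Hardy2_inner (model_kernel w) (B * g)
      = Hardy2_inner (szego w) (B * g) + - cnj (B w) * Hardy2_inner (B * szego w) (B * g)"
      unfolding model_kernel_def using s Bg by (simp only: Hardy2_inner_add_left Hardy2_inner_fscale_left A_space_fscale)
    also have "\<dots> = cnj ((B * g) w) - cnj (B w) * cnj (g w)"
      using Hardy2_inner_cnj[OF Bg s(1)] Hardy2_inner_cnj[OF g s(1)]
      by (simp add: Hardy2_inner_B[OF s(1) g] Hardy2_inner_szego[OF Bg w] Hardy2_inner_szego[OF g w])
    finally show ?thesis by simp
  qed
  then show ?thesis using k by (simp add: model_space_def Hardy2_def)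
qed

lemma Hardy2_inner_model_kernel:
  assumes v: "v \<in> model_space B" and w: "cmod w < 1"
  shows "Hardy2_inner v (model_kernel w) = v w"
proof -
  have v0: "v \<in> A_space 0" by (rule model_space_A_space[OF v])
  have s: "szego w \<in> A_space 0" "B * szego w \<in> A_space 0"
    by (intro B_mult_in_A_space szego_in_A_space w)+
  have "Hardy2_inner v (model_kernel w) = Hardy2_inner v (szego w) + Hardy2_inner v (fscale (- cnj (B w)) (B * szego w))"
    unfolding model_kernel_def using s v0 by (simp only: Hardy2_inner_add_right A_space_fscale)
  also have "\<dots> = v w"
    unfolding Hardy2_inner_fscale_right[OF s(2) v0] model_space_orth[OF v s(1)]
    by (simp add: Hardy2_inner_szego[OF v0 w])
  finally show ?thesis .
qed

lemma model_kernel_apply: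
  assumes "cmod w < 1" "cmod z < 1"
  shows "model_kernel w z = (1 - cnj (B w) * B z) / (1 - cnj w * z)"
  using assms by (simp add: model_kernel_def fscale_def szego_apply diff_divide_distrib)

text \<open>
  The kernel is in the span of the \<open>u\<^sub>j\<close>. Its coefficient at \<open>u\<^sub>j\<close> is its inner product with the dual
  vector \<open>v\<^sub>j\<close>, which by the reproducing property is \<open>cnj (v\<^sub>j w)\<close>.
\<close>

lemma model_kernel_expansion:
  assumes u: "basis_family n u (model_space B)"
  obtains v where "\<And>j. j \<in> {1..n} \<Longrightarrow> v j \<in> model_space B"
    "\<And>w z. cmod w < 1 \<Longrightarrow> cmod z < 1 \<Longrightarrow> model_kernel w z = (\<Sum>j=1..n. cnj (v j w) * u j z)"
proof -
  let ?S = "u ` {1..n}"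
  have inj: "inj_on u {1..n}" and ind: "cfun.independent ?S" and span: "cfun.span ?S = model_space B"
    using u by (auto simp: basis_family_def)
  have um: "u j \<in> model_space B" if "j \<in> {1..n}" for j
    using span that cfun.span_base[of "u j" ?S] by auto
  then have S: "?S \<subseteq> A_space 0" using model_space_A_space by auto
  have "\<exists>v. v \<in> model_space B \<and> Hardy2_inner (u j) v = 1 \<and> (\<forall>y\<in>?S - {u j}. Hardy2_inner y v = 0)"
    if "j \<in> {1..n}" for j
    using dual_vector_exists[OF _ S ind, of "u j"] that span by auto
  then obtain v where v: "\<And>j. j \<in> {1..n} \<Longrightarrow> v j \<in> model_space B"
    "\<And>j. j \<in> {1..n} \<Longrightarrow> Hardy2_inner (u j) (v j) = 1"
    "\<And>j y. j \<in> {1..n} \<Longrightarrow> y \<in> ?S - {u j} \<Longrightarrow> Hardy2_inner y (v j) = 0"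
    by metis
  have dual: "Hardy2_inner (u i) (v j) = (if i = j then 1 else 0)" if "i \<in> {1..n}" "j \<in> {1..n}" for i j
    using v(2)[OF that(2)] v(3)[OF that(2), of "u i"] that inj_on_eq_iff[OF inj that] by auto
  have "model_kernel w z = (\<Sum>j=1..n. cnj (v j w) * u j z)" if w: "cmod w < 1" and z: "cmod z < 1" for w z
  proof -
    have "model_kernel w \<in> cfun.span ?S" using model_kernel_in_model_space[OF w] span by simp
    then obtain d where "model_kernel w = (\<Sum>x\<in>?S. fscale (d x) x)"
      using cfun.span_finite[of ?S] by auto
    then have k: "model_kernel w = (\<Sum>j=1..n. fscale (d (u j)) (u j))"
      by (simp only: sum.reindex[OF inj] o_def)
    have lin: "Hardy2_inner (\<Sum>i\<in>I. fscale (d (u i)) (u i)) (v j) = (\<Sum>i\<in>I. d (u i) * Hardy2_inner (u i) (v j))"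
      if "j \<in> {1..n}" "I \<subseteq> {1..n}" for I j
    proof -
      have "finite I" using that(2) finite_subset by auto
      then show ?thesis using that(2)
      proof induction
        case empty
        have "Hardy2_inner 0 (v j) = 0"
          using Hardy2_inner_cnj[OF model_space_A_space[OF v(1)[OF that(1)]] A_space_0]
          by (simp only: Hardy2_inner_zero_right complex_cnj_zero)
        then show ?case by (simp only: sum.empty)
      next
        case (insert i I)
        have uA: "u i \<in> A_space 0" if "i \<in> {1..n}" for i using um[OF that] by (rule model_space_A_space)
        have A: "u i \<in> A_space 0" "fscale (d (u i)) (u i) \<in> A_space 0"
          using uA[of i] insert.prems by (auto intro: A_space_fscale)
        have s: "(\<Sum>i\<in>I. fscale (d (u i)) (u i)) \<in> A_space 0"
          using uA insert.prems by (intro A_space_sum A_space_fscale) auto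
        have vj: "v j \<in> A_space 0" by (rule model_space_A_space[OF v(1)[OF that(1)]])
        have "I \<subseteq> {1..n}" using insert.prems by simp
        then show ?case
          by (simp only: sum.insert[OF insert.hyps] Hardy2_inner_add_left[OF A(2) s vj]
            Hardy2_inner_fscale_left[OF A(1) vj] insert.IH)
      qed
    qed
    have "d (u j) = cnj (v j w)" if j: "j \<in> {1..n}" for j
    proof -
      have "Hardy2_inner (model_kernel w) (v j) = (\<Sum>i=1..n. d (u i) * Hardy2_inner (u i) (v j))"
        unfolding k by (rule lin) (use j in auto)
      also have "\<dots> = (\<Sum>i=1..n. if i = j then d (u i) else 0)"
        by (rule sum.cong) (use dual j in auto)
      also have "\<dots> = d (u j)" using j by simp
      finally show ?thesis
        using Hardy2_inner_model_kernel[OF v(1)[OF j] w]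
          Hardy2_inner_cnj[OF model_space_A_space[OF v(1)[OF j]] model_space_A_space[OF model_kernel_in_model_space[OF w]]]
        by simp
    qed
    then have k: "model_kernel w = (\<Sum>j=1..n. fscale (cnj (v j w)) (u j))" using k by simp
    have "(\<Sum>j\<in>I. fscale (cnj (v j w)) (u j)) z = (\<Sum>j\<in>I. cnj (v j w) * u j z)" for I
      by (induction I rule: infinite_finite_induct) (auto simp: fscale_def)
    then show ?thesis unfolding k .
  qed
  then show thesis using that v(1) by blast
qed

text \<open>
  For fixed \<open>z\<close>, conjugating and rearranging the kernel expansion gives
  \<open>szego z = \<Sum>j. cnj (u\<^sub>j z) (v\<^sub>j (szego (B z) \<circ> B))\<close> as functions of \<open>w\<close>. Its \<open>k\<close>-th Taylor coefficient,
  conjugated back, is the claim, since the coefficients of the summands are known from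
  \<open>comp_in_A_space\<close>.
\<close>

lemma monomial_decomposition:
  assumes u: "\<And>j. j \<in> {1..n} \<Longrightarrow> v j \<in> model_space B"
    and k: "\<And>w z. cmod w < 1 \<Longrightarrow> cmod z < 1 \<Longrightarrow> model_kernel w z = (\<Sum>j=1..n. cnj (v j w) * u j z)"
    and z: "cmod z < 1"
  shows "z ^ k = (\<Sum>j=1..n. u j z * (\<Sum>m. adjoint_matrix (comp_matrix (v j)) m k * B z ^ m))"
proof -
  have Bz: "cmod (B z) < 1" by (rule B_in_disc[OF z])
  define g where "g j = v j * (szego (B z) \<circ> B)" for j
  have gA: "g j \<in> A_space 0" "coef (g j) = mat_app (comp_matrix (v j)) (\<lambda>m. cnj (B z) ^ m)" if "j \<in> {1..n}" for j
    using comp_in_A_space[OF u[OF that] szego_in_A_space(1)[OF Bz, of 0]]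
    by (simp_all add: g_def szego_in_A_space(2)[OF Bz])
  have nz: "1 - cnj x * y \<noteq> 0" if "cmod x < 1" "cmod y < 1" for x y
    by (rule one_minus_cnj_mult_nonzero[of 1]) (use that in auto)
  have "szego z w = (\<Sum>j=1..n. cnj (u j z) * g j w)" if w: "cmod w < 1" for w
  proof -
    have Bw: "cmod (B w) < 1" by (rule B_in_disc[OF w])
    have "cnj (model_kernel w z) = (\<Sum>j=1..n. cnj (u j z) * v j w)"
      unfolding k[OF w z] by (simp add: mult.commute)
    then have "(1 - cnj (B z) * B w) / (1 - cnj z * w) = (\<Sum>j=1..n. cnj (u j z) * v j w)"
      by (simp add: model_kernel_apply[OF w z] mult.commute)
    then have "1 / (1 - cnj z * w) = (\<Sum>j=1..n. cnj (u j z) * v j w) / (1 - cnj (B z) * B w)"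
      using nz[OF Bz Bw] nz[OF z w] by (simp add: field_simps)
    then show ?thesis
      by (simp add: szego_apply[OF z w] g_def szego_apply[OF Bz Bw] sum_divide_distrib)
  qed
  moreover have "(\<lambda>k. (\<Sum>j=1..n. cnj (u j z) * coef (g j) k) * w ^ k) sums (\<Sum>j=1..n. cnj (u j z) * g j w)"
    if w: "cmod w < 1" for w
  proof -
    have "(\<lambda>k. \<Sum>j=1..n. cnj (u j z) * (coef (g j) k * w ^ k)) sums (\<Sum>j=1..n. cnj (u j z) * g j w)"
      by (intro sums_sum sums_mult coef_sums A_space_holo[OF gA(1)] w)
    then show ?thesis by (simp add: sum_distrib_right mult.assoc)
  qed
  ultimately have "coef (szego z) = (\<lambda>k. \<Sum>j=1..n. cnj (u j z) * coef (g j) k)"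
    by (intro coef_eqI) auto
  then have "cnj z ^ k = (\<Sum>j=1..n. cnj (u j z) * coef (g j) k)"
    by (simp add: szego_in_A_space(2)[OF z])
  also have "\<dots> = (\<Sum>j=1..n. cnj (u j z) * (\<Sum>m. comp_matrix (v j) k m * cnj (B z) ^ m))"
    by (intro sum.cong refl) (simp add: gA(2) mat_app_def)
  also have "\<dots> = (\<Sum>j=1..n. cnj (u j z * (\<Sum>m. adjoint_matrix (comp_matrix (v j)) m k * B z ^ m)))"
  proof (rule sum.cong)
    fix j assume j: "j \<in> {1..n}"
    have "(\<lambda>k. cnj (B z) ^ k) \<in> weighted_l2 0"
      using szego_in_A_space(1)[OF Bz, of 0] by (simp add: A_space_iff szego_in_A_space(2)[OF Bz])
    then have "(\<lambda>m. comp_matrix (v j) k m * cnj (B z) ^ m) sums (\<Sum>m. comp_matrix (v j) k m * cnj (B z) ^ m)"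
      by (intro summable_sums section_bounded_row_summable[OF comp_matrix_section_bounded_0[OF u[OF j]]])
    then have "(\<lambda>m. cnj (comp_matrix (v j) k m * cnj (B z) ^ m)) sums cnj (\<Sum>m. comp_matrix (v j) k m * cnj (B z) ^ m)"
      by (simp only: sums_cnj)
    then have "(\<Sum>m. adjoint_matrix (comp_matrix (v j)) m k * B z ^ m) = cnj (\<Sum>m. comp_matrix (v j) k m * cnj (B z) ^ m)"
      by (simp add: adjoint_matrix_def sums_iff)
    then show "cnj (u j z) * (\<Sum>m. comp_matrix (v j) k m * cnj (B z) ^ m) = cnj (u j z * (\<Sum>m. adjoint_matrix (comp_matrix (v j)) m k * B z ^ m))"
      by simp
  qed simp
  finally have "cnj (cnj z ^ k) = cnj (\<Sum>j=1..n. cnj (u j z * (\<Sum>m. adjoint_matrix (comp_matrix (v j)) m k * B z ^ m)))"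
    by simp
  then show ?thesis by simp
qed

text \<open>
  A column is the image of a unit vector.
\<close>

lemma column_in_weighted_l2:
  assumes "v \<in> model_space B"
  shows "(\<lambda>m. adjoint_matrix (comp_matrix v) m k) \<in> weighted_l2 \<alpha>"
proof -
  obtain C where C: "section_bounded \<alpha> (adjoint_matrix (comp_matrix v)) C" using comp_matrix_adjoint_matrix_section_bounded[OF assms] .
  have "mat_app (adjoint_matrix (comp_matrix v)) (trunc (Suc k) (\<lambda>i. if i = k then 1 else 0)) \<in> weighted_l2 \<alpha>"
    by (rule mat_app_bounded[OF C]) simp
  moreover have "mat_app (adjoint_matrix (comp_matrix v)) (trunc (Suc k) (\<lambda>i. if i = k then 1 else 0)) = (\<lambda>m. adjoint_matrix (comp_matrix v) m k)"
    by (simp add: fun_eq_iff mat_app_trunc if_distrib[where f = "\<lambda>x. _ * x"] cong: if_cong)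
  ultimately show ?thesis by simp
qed

text \<open>
  The component \<open>F\<^sub>j\<close> is the image of \<open>f\<close> under the adjoint of the composition matrix of \<open>v\<^sub>j\<close>. For Taylor
  polynomials the formula is a linear combination of \<open>monomial_decomposition\<close>; boundedness of the adjoint on
  the weighted space allows the limit.
\<close>

theorem decomposition:
  assumes u: "basis_family n u (model_space B)" and f: "f \<in> A_space \<alpha>"
  obtains F where "\<And>j. j \<in> {1..n} \<Longrightarrow> F j \<in> A_space \<alpha>" "f = (\<Sum>j=1..n. u j * (F j \<circ> B))"
proof -
  obtain v where v: "\<And>j. j \<in> {1..n} \<Longrightarrow> v j \<in> model_space B"
    and k: "\<And>w z. cmod w < 1 \<Longrightarrow> cmod z < 1 \<Longrightarrow> model_kernel w z = (\<Sum>j=1..n. cnj (v j w) * u j z)"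
    using model_kernel_expansion[OF u] by blast
  have um: "u j \<in> model_space B" if "j \<in> {1..n}" for j
    using u that cfun.span_base[of "u j" "u ` {1..n}"] by (auto simp: basis_family_def)
  let ?t = "\<lambda>j. adjoint_matrix (comp_matrix (v j))"
  define F where "F j = disc_series (mat_app (?t j) (coef f))" for j
  have cf: "coef f \<in> weighted_l2 \<alpha>" using f by (simp add: A_space_iff)
  have bd: "\<exists>C. section_bounded \<alpha> (?t j) C" if "j \<in> {1..n}" for j
    using comp_matrix_adjoint_matrix_section_bounded[OF v[OF that]] by metis
  have m: "mat_app (?t j) (coef f) \<in> weighted_l2 \<alpha>" if "j \<in> {1..n}" for j
    using bd[OF that] mat_app_bounded(1) cf by blast
  have FA: "F j \<in> A_space \<alpha>" if "j \<in> {1..n}" for j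
    unfolding F_def by (intro disc_series_in_A_space m that)
  have sum_apply: "(\<Sum>j\<in>I. u j * (F j \<circ> B)) z = (\<Sum>j\<in>I. u j z * F j (B z))" for I z
    by (induction I rule: infinite_finite_induct) auto
  have "f = (\<Sum>j=1..n. u j * (F j \<circ> B))"
  proof (rule disc_analytic_eqI)
    show "f \<in> disc_analytic" using f by (simp add: A_space_iff)
    have "(\<Sum>j=1..n. u j * (F j \<circ> B)) \<in> A_space \<alpha>"
      by (intro A_space_sum comp_in_A_space um FA)
    then show "(\<Sum>j=1..n. u j * (F j \<circ> B)) \<in> disc_analytic" by (simp add: A_space_iff)
    fix z :: complex assume z: "cmod z < 1"
    have Bz: "cmod (B z) < 1" by (rule B_in_disc[OF z])
    let ?a = "\<lambda>N. trunc N (coef f)"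
    have fin: "(\<Sum>j=1..n. u j z * (\<Sum>m. mat_app (?t j) (?a N) m * B z ^ m)) = (\<Sum>k<N. coef f k * z ^ k)" for N
    proof -
      have "(\<Sum>m. mat_app (?t j) (?a N) m * B z ^ m) = (\<Sum>k<N. coef f k * (\<Sum>m. ?t j m k * B z ^ m))"
        if j: "j \<in> {1..n}" for j
      proof -
        have "summable (\<lambda>m. ?t j m k * B z ^ m)" for k
          by (rule summable_norm_cancel, rule weighted_l2_power_series_summable(1)[OF column_in_weighted_l2[OF v[OF j]] Bz])
        then have "(\<lambda>m. \<Sum>k<N. coef f k * (?t j m k * B z ^ m)) sums (\<Sum>k<N. coef f k * (\<Sum>m. ?t j m k * B z ^ m))"
          by (intro sums_sum sums_mult summable_sums)
        moreover have "mat_app (?t j) (?a N) m * B z ^ m = (\<Sum>k<N. coef f k * (?t j m k * B z ^ m))" for m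
          by (simp only: mat_app_trunc sum_distrib_right) (simp add: mult_ac)
        ultimately show ?thesis by (simp only: sums_iff)
      qed
      then have "(\<Sum>j=1..n. u j z * (\<Sum>m. mat_app (?t j) (?a N) m * B z ^ m))
        = (\<Sum>j=1..n. \<Sum>k<N. coef f k * (u j z * (\<Sum>m. ?t j m k * B z ^ m)))"
        by (simp add: sum_distrib_left mult_ac)
      also have "\<dots> = (\<Sum>k<N. coef f k * (\<Sum>j=1..n. u j z * (\<Sum>m. ?t j m k * B z ^ m)))"
        by (subst sum.swap) (simp add: sum_distrib_left)
      also have "\<dots> = (\<Sum>k<N. coef f k * z ^ k)"
        by (simp only: monomial_decomposition[OF v k z, symmetric])
      finally show ?thesis .
    qed
    show "f z = (\<Sum>j=1..n. u j * (F j \<circ> B)) z"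
    proof (rule LIMSEQ_unique)
      show "(\<lambda>N. \<Sum>k<N. coef f k * z ^ k) \<longlonglongrightarrow> f z"
        using coef_sums[OF A_space_holo[OF f] z] by (simp add: sums_def)
      have "(\<lambda>N. \<Sum>m. mat_app (?t j) (?a N) m * B z ^ m) \<longlonglongrightarrow> F j (B z)" if j: "j \<in> {1..n}" for j
      proof -
        obtain C where C: "section_bounded \<alpha> (?t j) C" using bd[OF j] by blast
        show ?thesis
          unfolding F_def disc_series_def using Bz
          by (auto intro!: power_series_tendsto[OF m[OF j] _ mat_app_trunc_tendsto[OF C cf] Bz] mat_app_bounded[OF C])
      qed
      then have "(\<lambda>N. \<Sum>j=1..n. u j z * (\<Sum>m. mat_app (?t j) (?a N) m * B z ^ m)) \<longlonglongrightarrow> (\<Sum>j=1..n. u j z * F j (B z))"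
        by (intro tendsto_sum tendsto_mult tendsto_const)
      then show "(\<lambda>N. \<Sum>k<N. coef f k * z ^ k) \<longlonglongrightarrow> (\<Sum>j=1..n. u j * (F j \<circ> B)) z"
        by (simp only: fin sum_apply)
    qed
  qed
  with FA show thesis by (rule that)
qed

end

section \<open>Operators commuting with multiplication by the Blaschke product\<close>

lemma bounded_operator_sum:
  assumes W: "bounded_operator \<alpha> W" and "\<And>i. i \<in> I \<Longrightarrow> f i \<in> A_space \<alpha>"
  shows "W (\<Sum>i\<in>I. f i) = (\<Sum>i\<in>I. W (f i))"
proof -
  have W0: "W 0 = 0"
  proof -
    have "W (fscale 0 0) = fscale 0 (W 0)"
      using W A_space_0 unfolding bounded_operator_def by blast
    then show ?thesis by simp
  qed
  show ?thesis
    using assms(2)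
  proof (induction I rule: infinite_finite_induct)
    case (insert i I)
    have "W (f i + (\<Sum>i\<in>I. f i)) = W (f i) + W (\<Sum>i\<in>I. f i)"
      using W insert.prems A_space_sum[of I f \<alpha>] unfolding bounded_operator_def by blast
    also have "W (\<Sum>i\<in>I. f i) = (\<Sum>i\<in>I. W (f i))"
      using insert.IH insert.prems by blast
    finally show ?case by (simp only: sum.insert[OF insert.hyps])
  qed (auto simp: W0)
qed

lemma bounded_operator_pointwise:
  assumes W: "bounded_operator \<alpha> W" and f: "f \<in> A_space \<alpha>" "\<And>N. g N \<in> A_space \<alpha>"
    and lim: "(\<lambda>N. sqnorm \<alpha> (\<lambda>k. coef f k - coef (g N) k)) \<longlonglongrightarrow> 0" and z: "cmod z < 1"
  shows "(\<lambda>N. W (g N) z) \<longlonglongrightarrow> W f z"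
proof -
  have WA: "W h \<in> A_space \<alpha>" if "h \<in> A_space \<alpha>" for h
    using W that unfolding bounded_operator_def by blast
  obtain C where C: "\<And>h. h \<in> A_space \<alpha> \<Longrightarrow> A_norm \<alpha> (W h) \<le> C * A_norm \<alpha> h"
    using W unfolding bounded_operator_def by blast
  have diff: "coef (p - q) = (\<lambda>k. coef p k - coef q k)" if "p \<in> A_space \<alpha>" "q \<in> A_space \<alpha>" for p q
    using that by (intro ext coef_diff A_space_holo)
  have l: "coef h \<in> weighted_l2 \<alpha>" if "h \<in> A_space \<alpha>" for h using that by (simp add: A_space_iff)
  have Wd: "W (f - g N) = W f - W (g N)" for N
  proof -
    have "W (f + fscale (-1) (g N)) = W f + fscale (-1) (W (g N))"
      using W f A_space_fscale[OF f(2)[of N], of "-1"] unfolding bounded_operator_def by metis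
    then show ?thesis unfolding fun_diff_eq .
  qed
  have b: "sqnorm \<alpha> (\<lambda>k. coef (W f) k - coef (W (g N)) k) \<le> C\<^sup>2 * sqnorm \<alpha> (\<lambda>k. coef f k - coef (g N) k)" for N
  proof -
    have d: "f - g N \<in> A_space \<alpha>" by (intro A_space_diff f)
    have "sqrt (sqnorm \<alpha> (coef (W (f - g N)))) \<le> C * sqrt (sqnorm \<alpha> (coef (f - g N)))"
      using C[OF d] by (simp add: A_norm_eq)
    then have "(sqrt (sqnorm \<alpha> (coef (W (f - g N)))))\<^sup>2 \<le> (C * sqrt (sqnorm \<alpha> (coef (f - g N))))\<^sup>2"
      by (intro power_mono) (use sqnorm_nonneg[OF l[OF WA[OF d]]] in auto)
    then have "sqnorm \<alpha> (coef (W (f - g N))) \<le> C\<^sup>2 * sqnorm \<alpha> (coef (f - g N))"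
      using sqnorm_nonneg[OF l[OF WA[OF d]]] sqnorm_nonneg[OF l[OF d]] by (simp add: power_mult_distrib)
    then show ?thesis unfolding Wd diff[OF WA[OF f(1)] WA[OF f(2)]] diff[OF f(1) f(2)] .
  qed
  have "(\<lambda>N. sqnorm \<alpha> (\<lambda>k. coef (W f) k - coef (W (g N)) k)) \<longlonglongrightarrow> 0"
  proof (rule tendsto_sandwich)
    show "\<forall>\<^sub>F N in sequentially. 0 \<le> sqnorm \<alpha> (\<lambda>k. coef (W f) k - coef (W (g N)) k)"
      by (intro always_eventually allI sqnorm_nonneg weighted_l2_diff l WA f)
    show "\<forall>\<^sub>F N in sequentially. sqnorm \<alpha> (\<lambda>k. coef (W f) k - coef (W (g N)) k)
        \<le> C\<^sup>2 * sqnorm \<alpha> (\<lambda>k. coef f k - coef (g N) k)"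
      using b by simp
    show "(\<lambda>N. C\<^sup>2 * sqnorm \<alpha> (\<lambda>k. coef f k - coef (g N) k)) \<longlonglongrightarrow> 0"
      using tendsto_mult[OF tendsto_const[of "C\<^sup>2"] lim] by simp
  qed auto
  from power_series_tendsto[OF l[OF WA[OF f(1)]] l[OF WA[OF f(2)]] this z] show ?thesis
    by (simp add: A_space_series[OF WA[OF f(1)] z] A_space_series[OF WA[OF f(2)] z])
qed

context blaschke
begin

text \<open>
  Commuting with \<open>B\<close> gives the formula for \<open>v B^m\<close>, linearity for the twisted Taylor polynomials of \<open>f\<close>, and
  continuity of \<open>W\<close> for \<open>f\<close> itself.
\<close>

lemma commuting_operator_comp:
  assumes W: "bounded_operator \<alpha> W" and comm: "\<forall>f\<in>A_space \<alpha>. W (T_op B f) = T_op B (W f)"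
    and v: "v \<in> model_space B" and f: "f \<in> A_space \<alpha>"
  shows "W (v * (f \<circ> B)) = W v * (f \<circ> B)"
proof (rule disc_analytic_eqI)
  have vA: "v \<in> A_space \<alpha>" by (rule model_space_subset_A_space[OF v])
  have WA: "W h \<in> A_space \<alpha>" if "h \<in> A_space \<alpha>" for h
    using W that unfolding bounded_operator_def by blast
  have hA: "v * (f \<circ> B) \<in> A_space \<alpha>" by (rule comp_in_A_space[OF v f])
  show "W (v * (f \<circ> B)) \<in> disc_analytic" using WA[OF hA] by (simp add: A_space_iff)
  have "f \<circ> B holomorphic_on ball 0 1"
  proof (rule holomorphic_on_compose_gen)
    have "B_ext holomorphic_on ball 0 1" by (rule holomorphic_on_subset[OF B_ext_holo]) (use R in auto)
    then show "B holomorphic_on ball 0 1"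
      by (rule holomorphic_transform) (simp add: B_eq_B_ext)
    show "f holomorphic_on ball 0 1" by (rule A_space_holo[OF f])
  qed (auto simp: B_in_disc)
  then show "W v * (f \<circ> B) \<in> disc_analytic"
    using disc_analytic_mult[of "f \<circ> B" "W v"] WA[OF vA] by (simp add: A_space_iff mult.commute)
  fix z :: complex assume z: "cmod z < 1"
  have Bz: "cmod (B z) < 1" by (rule B_in_disc[OF z])
  have Wpow: "W (twisted_pow v m) = twisted_pow (W v) m" for m
  proof (induction m)
    case (Suc m)
    have "W (T_op B (twisted_pow v m)) = T_op B (W (twisted_pow v m))"
      using comm twisted_pow_in_A_space[OF vA] by blast
    then show ?case unfolding T_op_def twisted_pow_Suc Suc .
  qed (simp add: twisted_pow_0)
  have Wcomb: "W (twisted_poly v N x) = twisted_poly (W v) N x" for N x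
  proof -
    have "W (twisted_poly v N x) = (\<Sum>m<N. W (fscale (x m) (twisted_pow v m)))"
      unfolding twisted_poly_def by (intro bounded_operator_sum[OF W] A_space_fscale twisted_pow_in_A_space[OF vA])
    also have "\<dots> = (\<Sum>m<N. fscale (x m) (twisted_pow (W v) m))"
    proof (rule sum.cong)
      fix m
      have "W (fscale (x m) (twisted_pow v m)) = fscale (x m) (W (twisted_pow v m))"
        using W twisted_pow_in_A_space[OF vA] unfolding bounded_operator_def by blast
      then show "W (fscale (x m) (twisted_pow v m)) = fscale (x m) (twisted_pow (W v) m)" by (simp add: Wpow)
    qed simp
    finally show ?thesis by (simp add: twisted_poly_def)
  qed
  obtain C where C: "section_bounded \<alpha> (comp_matrix v) C" using comp_matrix_section_bounded[OF v] .
  have cf: "coef f \<in> weighted_l2 \<alpha>" using f by (simp add: A_space_iff)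
  have cv: "coef (twisted_poly v N (coef f)) = mat_app (comp_matrix v) (trunc N (coef f))" for N
    by (simp add: fun_eq_iff coef_twisted_poly[OF vA] mat_app_trunc)
  show "W (v * (f \<circ> B)) z = (W v * (f \<circ> B)) z"
  proof (rule LIMSEQ_unique)
    show "(\<lambda>N. W (twisted_poly v N (coef f)) z) \<longlonglongrightarrow> W (v * (f \<circ> B)) z"
    proof (rule bounded_operator_pointwise[OF W hA twisted_poly_in_A_space[OF vA] _ z])
      show "(\<lambda>N. sqnorm \<alpha> (\<lambda>k. coef (v * (f \<circ> B)) k - coef (twisted_poly v N (coef f)) k)) \<longlonglongrightarrow> 0"
        unfolding comp_in_A_space(2)[OF v f] cv by (rule mat_app_trunc_tendsto[OF C cf])
    qed
    have "(\<lambda>m. W v z * (coef f m * B z ^ m)) sums (W v z * f (B z))"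
      by (intro sums_mult coef_sums A_space_holo[OF f] Bz)
    then show "(\<lambda>N. W (twisted_poly v N (coef f)) z) \<longlonglongrightarrow> (W v * (f \<circ> B)) z"
      by (simp add: Wcomb twisted_poly_apply sums_def mult_ac)
  qed
qed

lemma commutes_iff:
  assumes u: "basis_family n u (model_space B)" and W: "bounded_operator \<alpha> W"
  shows "(\<forall>f\<in>A_space \<alpha>. W (T_op B f) = T_op B (W f)) \<longleftrightarrow>
    (\<exists>\<phi> :: nat \<Rightarrow> complex \<Rightarrow> complex.
       (\<forall>k\<in>{1..n}. \<phi> k \<in> multipliers \<alpha>) \<and>
       (\<forall>f :: nat \<Rightarrow> complex \<Rightarrow> complex. (\<forall>j\<in>{1..n}. f j \<in> A_space \<alpha>) \<longrightarrow>
          W (\<Sum>j=1..n. u j * (f j \<circ> B)) = (\<Sum>k=1..n. \<phi> k * (f k \<circ> B))))"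
    (is "?L \<longleftrightarrow> ?R")
proof
  have um: "u j \<in> model_space B" if "j \<in> {1..n}" for j
    using u that cfun.span_base[of "u j" "u ` {1..n}"] by (auto simp: basis_family_def)
  have WA: "W h \<in> A_space \<alpha>" if "h \<in> A_space \<alpha>" for h
    using W that unfolding bounded_operator_def by blast
  {
    assume comm: ?L
    have Wu: "W (u j * (g \<circ> B)) = W (u j) * (g \<circ> B)" if "j \<in> {1..n}" "g \<in> A_space \<alpha>" for j g
      by (rule commuting_operator_comp[OF W comm um[OF that(1)] that(2)])
    show ?R
    proof (intro exI[of _ "\<lambda>k. W (u k)"] conjI ballI allI impI)
      fix k assume k: "k \<in> {1..n}"
      have Wk: "W (u k) \<in> A_space \<alpha>" by (intro WA model_space_subset_A_space um k)
      have "W (u k) * f \<in> A_space \<alpha>" if f: "f \<in> A_space \<alpha>" for f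
      proof -
        obtain F where F: "\<And>j. j \<in> {1..n} \<Longrightarrow> F j \<in> A_space \<alpha>" "f = (\<Sum>j=1..n. u j * (F j \<circ> B))"
          using decomposition[OF u f] by blast
        have "W (u k) * f = (\<Sum>j=1..n. u j * (W (u k) * (F j \<circ> B)))"
          unfolding F(2) by (simp add: sum_distrib_left mult_ac)
        also have "\<dots> = (\<Sum>j=1..n. u j * W (u k * (F j \<circ> B)))"
          by (intro sum.cong refl) (simp add: Wu[OF k F(1)])
        also have "\<dots> \<in> A_space \<alpha>"
          by (intro A_space_sum model_space_mult um WA comp_in_A_space k F(1))
        finally show ?thesis .
      qed
      then show "W (u k) \<in> multipliers \<alpha>" using Wk by (simp add: multipliers_def A_space_iff)
    next
      fix f :: "nat \<Rightarrow> complex \<Rightarrow> complex" assume f: "\<forall>j\<in>{1..n}. f j \<in> A_space \<alpha>"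
      have "W (\<Sum>j=1..n. u j * (f j \<circ> B)) = (\<Sum>j=1..n. W (u j * (f j \<circ> B)))"
        by (intro bounded_operator_sum[OF W] comp_in_A_space um) (use f in auto)
      also have "\<dots> = (\<Sum>k=1..n. W (u k) * (f k \<circ> B))"
        by (intro sum.cong refl Wu) (use f in auto)
      finally show "W (\<Sum>j=1..n. u j * (f j \<circ> B)) = (\<Sum>k=1..n. W (u k) * (f k \<circ> B))" .
    qed
  next
    assume ?R
    then obtain \<phi> where \<phi>: "\<And>k. k \<in> {1..n} \<Longrightarrow> \<phi> k \<in> multipliers \<alpha>"
      and rep: "\<And>f. (\<forall>j\<in>{1..n}. f j \<in> A_space \<alpha>) \<Longrightarrow>
        W (\<Sum>j=1..n. u j * (f j \<circ> B)) = (\<Sum>k=1..n. \<phi> k * (f k \<circ> B))"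
      by blast
    show ?L
    proof
      fix f assume f: "f \<in> A_space \<alpha>"
      obtain F where F: "\<And>j. j \<in> {1..n} \<Longrightarrow> F j \<in> A_space \<alpha>" "f = (\<Sum>j=1..n. u j * (F j \<circ> B))"
        using decomposition[OF u f] by blast
      \<comment> \<open>Multiplying each component by the coordinate multiplies the sum by B.\<close>
      have z: "shift g \<circ> B = B * (g \<circ> B)" for g by (simp add: fun_eq_iff shift_def)
      have "T_op B f = (\<Sum>j=1..n. u j * (shift (F j) \<circ> B))"
        unfolding T_op_def F(2) z by (simp add: sum_distrib_left mult_ac)
      then have "W (T_op B f) = (\<Sum>k=1..n. \<phi> k * (shift (F k) \<circ> B))"
        using rep[of "\<lambda>j. shift (F j)"] F(1) shift_in_A_space by auto
      also have "\<dots> = B * (\<Sum>k=1..n. \<phi> k * (F k \<circ> B))"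
        unfolding z by (simp add: sum_distrib_left mult_ac)
      also have "\<dots> = T_op B (W f)"
        using rep[of F] F by (simp add: T_op_def)
      finally show "W (T_op B f) = T_op B (W f)" .
    qed
  }
qed

end

theorem theorem2p3:
  fixes \<alpha> :: real and n :: nat and B :: "complex \<Rightarrow> complex"
    and u :: "nat \<Rightarrow> complex \<Rightarrow> complex"
    and W :: "(complex \<Rightarrow> complex) \<Rightarrow> complex \<Rightarrow> complex"
  assumes "n \<ge> 1"
    and "finite_Blaschke_product n B"
    and "basis_family n u (model_space B)"
    and "bounded_operator \<alpha> W"
  shows "(\<forall>f\<in>A_space \<alpha>. W (T_op B f) = T_op B (W f)) \<longleftrightarrow>
    (\<exists>\<phi> :: nat \<Rightarrow> complex \<Rightarrow> complex.
       (\<forall>k\<in>{1..n}. \<phi> k \<in> multipliers \<alpha>) \<and>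
       (\<forall>f :: nat \<Rightarrow> complex \<Rightarrow> complex. (\<forall>j\<in>{1..n}. f j \<in> A_space \<alpha>) \<longrightarrow>
          W (\<Sum>j=1..n. u j * (f j \<circ> B)) = (\<Sum>k=1..n. \<phi> k * (f k \<circ> B))))"
proof -
  obtain c a R where "blaschke n B c a R"
    using finite_Blaschke_product_blaschke[OF assms(1,2)] .
  then interpret blaschke n B c a R .
  show ?thesis by (rule commutes_iff[OF assms(3,4)])
qed

end
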